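(* For every integer $t\geq 0$, the generating function $\displaystyle \sum_{n\geq 1}\left|\mathrm{Pop}_{B_n}^{-t}(e)\right|z^n$ is rational.
   Context: For a Coxeter system $(W,S)$ with length $\ell$, right weak order $x\leq_R y$ iff $\ell(x^{-1}y)=\ell(y)-\ell(x)$ (a complete meet-semilattice with meet $\bigwedge_R$), and right descent set $D_R(w)=\{s\in S:\ell(ws)<\ell(w)\}$, define $\mathrm{Pop}_W(w)=\bigwedge_R(\{ws:s\in D_R(w)\}\cup\{w\})$. Then $\mathrm{Pop}_W^{-t}(e)$ is the set of $w\in W$ with $\mathrm{Pop}_W^t(w)=e$. The hyperoctahedral group $B_n$ is the subgroup of the symmetric group $S_{2n}$ of permutations $w$ with $w_0ww_0=w$, where $w_0=(2n)(2n-1)\cdots 1$; it is a Coxeter group with simple generators $s_is_{2n-i}$ ($i\in[n-1]$) and $s_n$, where $s_i$ is the transposition of $i$ and $i+1$. *)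

theory Defs
  imports "HOL-Algebra.Sym_Groups" "HOL-Computational_Algebra.Polynomial_FPS"
begin

section \<open>Length, right weak order and the Pop operator of a pair \<open>(W, S)\<close>\<close>

text \<open>The definitions make sense for any group with a set of generators; they are meant to be
  applied to a Coxeter system. There the generators are involutions, so words need not contain
  inverses of generators.\<close>

definition word_prod :: "('a, 'b) monoid_scheme \<Rightarrow> 'a list \<Rightarrow> 'a"
  where "word_prod W ss = foldr (\<lambda>s x. s \<otimes>\<^bsub>W\<^esub> x) ss \<one>\<^bsub>W\<^esub>"

definition cox_length :: "('a, 'b) monoid_scheme \<Rightarrow> 'a set \<Rightarrow> 'a \<Rightarrow> nat"
  where "cox_length W S w = (LEAST k. \<exists>ss. set ss \<subseteq> S \<and> length ss = k \<and> word_prod W ss = w)"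

definition right_weak_order :: "('a, 'b) monoid_scheme \<Rightarrow> 'a set \<Rightarrow> 'a gorder"
  where "right_weak_order W S =
    \<lparr> carrier = carrier W,
      eq = (=),
      le = (\<lambda>x y. int (cox_length W S (inv\<^bsub>W\<^esub> x \<otimes>\<^bsub>W\<^esub> y))
                  = int (cox_length W S y) - int (cox_length W S x)) \<rparr>"

definition right_descents :: "('a, 'b) monoid_scheme \<Rightarrow> 'a set \<Rightarrow> 'a \<Rightarrow> 'a set"
  where "right_descents W S w = {s \<in> S. cox_length W S (w \<otimes>\<^bsub>W\<^esub> s) < cox_length W S w}"

definition pop :: "('a, 'b) monoid_scheme \<Rightarrow> 'a set \<Rightarrow> 'a \<Rightarrow> 'a"
  where "pop W S w =
    \<Sqinter>\<^bsub>right_weak_order W S\<^esub> ({w \<otimes>\<^bsub>W\<^esub> s | s. s \<in> right_descents W S w} \<union> {w})"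

definition pop_preimage_one :: "('a, 'b) monoid_scheme \<Rightarrow> 'a set \<Rightarrow> nat \<Rightarrow> 'a set"
  where "pop_preimage_one W S t = {w \<in> carrier W. (pop W S ^^ t) w = \<one>\<^bsub>W\<^esub>}"


section \<open>The hyperoctahedral group\<close>

text \<open>The reversal \<open>(2n)(2n-1)\<cdots>1\<close>, extended by the identity outside \<open>{1..2n}\<close> as
  required for membership in \<^const>\<open>sym_group\<close>.\<close>

definition rev_perm :: "nat \<Rightarrow> nat \<Rightarrow> nat"
  where "rev_perm n i = (if i \<in> {1..2*n} then 2*n + 1 - i else i)"

definition hyperoct_group :: "nat \<Rightarrow> (nat \<Rightarrow> nat) monoid"
  where "hyperoct_group n = (sym_group (2*n))
    \<lparr> carrier := {w \<in> carrier (sym_group (2*n)). rev_perm n \<circ> w \<circ> rev_perm n = w} \<rparr>"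

definition simple_transp :: "nat \<Rightarrow> nat \<Rightarrow> nat"
  where "simple_transp i = Transposition.transpose i (i + 1)"

definition hyperoct_gens :: "nat \<Rightarrow> (nat \<Rightarrow> nat) set"
  where "hyperoct_gens n =
    {simple_transp i \<circ> simple_transp (2*n - i) | i. 1 \<le> i \<and> i < n} \<union> {simple_transp n}"

lemma rev_perm_permutes: "rev_perm n permutes {1..2*n}"
proof (rule bij_imp_permutes)
  show "bij_betw (rev_perm n) {1..2*n} {1..2*n}"
    by (rule bij_betw_byWitness[where f' = "rev_perm n"]) (auto simp: rev_perm_def)
qed (auto simp: rev_perm_def)

lemma rev_perm_rev_perm [simp]: "rev_perm n (rev_perm n x) = x"
  by (auto simp: rev_perm_def)

lemma hyperoct_group_is_group: "group (hyperoct_group n)"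
proof -
  interpret S: group "sym_group (2*n)" by (rule sym_group_is_group)
  let ?r = "rev_perm n"
  have r: "?r \<in> carrier (sym_group (2*n))"
    unfolding sym_group_carrier by (rule rev_perm_permutes)
  have rr: "?r \<otimes>\<^bsub>sym_group (2*n)\<^esub> ?r = \<one>\<^bsub>sym_group (2*n)\<^esub>"
    by (simp add: sym_group_mult sym_group_one fun_eq_iff)
  have inv_r: "inv\<^bsub>sym_group (2*n)\<^esub> ?r = ?r"
    using S.inv_equality[OF rr r r] .
  have "subgroup {w \<in> carrier (sym_group (2*n)). ?r \<circ> w \<circ> ?r = w} (sym_group (2*n))"
  proof (rule S.subgroupI, goal_cases)
    case 2
    have "id \<in> {w \<in> carrier (sym_group (2*n)). ?r \<circ> w \<circ> ?r = w}"
      by (simp add: sym_group_carrier permutes_id fun_eq_iff)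
    then show ?case by blast
  next
    case (3 w)
    then have w: "w \<in> carrier (sym_group (2*n))"
      and eq: "?r \<otimes>\<^bsub>sym_group (2*n)\<^esub> w \<otimes>\<^bsub>sym_group (2*n)\<^esub> ?r = w"
      by (simp_all add: sym_group_mult)
    have "inv\<^bsub>sym_group (2*n)\<^esub> w
        = inv\<^bsub>sym_group (2*n)\<^esub> (?r \<otimes>\<^bsub>sym_group (2*n)\<^esub> w \<otimes>\<^bsub>sym_group (2*n)\<^esub> ?r)"
      by (simp only: eq)
    also have "\<dots> = ?r \<otimes>\<^bsub>sym_group (2*n)\<^esub> inv\<^bsub>sym_group (2*n)\<^esub> w \<otimes>\<^bsub>sym_group (2*n)\<^esub> ?r"
      using w r by (simp only: S.inv_mult_group S.m_assoc S.m_closed S.inv_closed inv_r)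
    finally show ?case using S.inv_closed[OF w] by (simp add: sym_group_mult)
  next
    case (4 v w)
    have "?r \<circ> (v \<circ> w) \<circ> ?r = (?r \<circ> v \<circ> ?r) \<circ> (?r \<circ> w \<circ> ?r)"
      by (simp add: fun_eq_iff)
    with 4 show ?case
      by (auto simp: sym_group_mult sym_group_carrier permutes_compose)
  qed auto
  then show ?thesis
    unfolding hyperoct_group_def by (rule S.subgroup_imp_group)
qed

lemma rev_perm_conj_simple_transp:
  assumes "1 \<le> i" "i < 2*n"
  shows "rev_perm n \<circ> simple_transp i \<circ> rev_perm n = simple_transp (2*n - i)"
proof
  fix x
  have ends: "rev_perm n i = 2*n - i + 1" "rev_perm n (i + 1) = 2*n - i"
    using assms by (auto simp: rev_perm_def)
  have "rev_perm n x = y \<longleftrightarrow> x = rev_perm n y" for y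
    by (metis rev_perm_rev_perm)
  then have "rev_perm n (Transposition.transpose i (i + 1) (rev_perm n x))
      = Transposition.transpose (rev_perm n i) (rev_perm n (i + 1)) x"
    by (simp only: Transposition.transpose_def if_distrib[of "rev_perm n"] rev_perm_rev_perm)
  then show "(rev_perm n \<circ> simple_transp i \<circ> rev_perm n) x = simple_transp (2*n - i) x"
    by (simp only: ends simple_transp_def comp_apply transpose_commute)
qed

lemma simple_transp_permutes:
  assumes "1 \<le> i" "i < m"
  shows "simple_transp i permutes {1..m}"
  unfolding simple_transp_def using assms by (intro permutes_swap_id) auto

lemma simple_transp_commute:
  assumes "i + 1 < j"
  shows "simple_transp j \<circ> simple_transp i = simple_transp i \<circ> simple_transp j"
  using assms unfolding simple_transp_def fun_eq_iff comp_apply Transposition.transpose_def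
  by simp

lemma hyperoct_gens_subset:
  assumes "n \<ge> 1"
  shows "hyperoct_gens n \<subseteq> carrier (hyperoct_group n)"
proof
  fix s assume "s \<in> hyperoct_gens n"
  then consider (pair) i where "1 \<le> i" "i < n" "s = simple_transp i \<circ> simple_transp (2*n - i)"
    | (mid) "s = simple_transp n"
    unfolding hyperoct_gens_def by blast
  then show "s \<in> carrier (hyperoct_group n)"
  proof cases
    case pair
    have "simple_transp i permutes {1..2*n}" "simple_transp (2*n - i) permutes {1..2*n}"
      by (rule simple_transp_permutes; use pair(1,2) in linarith)+
    then have "s permutes {1..2*n}"
      unfolding pair(3) by (intro permutes_compose)
    moreover have "rev_perm n \<circ> s \<circ> rev_perm n = s"
    proof -
      have "rev_perm n \<circ> s \<circ> rev_perm n
          = (rev_perm n \<circ> simple_transp i \<circ> rev_perm n)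
            \<circ> (rev_perm n \<circ> simple_transp (2*n - i) \<circ> rev_perm n)"
        unfolding pair(3) by (simp add: fun_eq_iff)
      also have "\<dots> = simple_transp (2*n - i) \<circ> simple_transp i"
        using pair(1,2) by (simp add: rev_perm_conj_simple_transp)
      also have "\<dots> = s"
        unfolding pair(3) using pair(1,2) by (intro simple_transp_commute) linarith
      finally show ?thesis .
    qed
    ultimately show ?thesis
      by (simp add: hyperoct_group_def sym_group_def)
  next
    case mid
    have "s permutes {1..2*n}"
      unfolding mid by (rule simple_transp_permutes; use assms in linarith)
    moreover have "rev_perm n \<circ> s \<circ> rev_perm n = s"
      using mid assms rev_perm_conj_simple_transp[of n n] by simp
    ultimately show ?thesis
      by (simp add: hyperoct_group_def sym_group_def)
  qed
qed


section \<open>Rational power series\<close>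

text \<open>Rationality is stated with the denominator cleared because division of formal power series
  by a series without constant term is not exact in general.\<close>

definition rational_fps :: "'a :: field fps \<Rightarrow> bool"
  where "rational_fps F \<longleftrightarrow> (\<exists>p q. q \<noteq> 0 \<and> F * fps_of_poly q = fps_of_poly p)"

end

theory Submission
  imports Defs
begin

text \<open>\<open>Pop\<close> reverses the maximal descending runs of the one-line notation, so a permutation \<open>w\<close>
  with \<open>Pop\<^sup>t(w) = e\<close> is determined by the ascent sets of \<open>w, Pop(w), \<dots>, Pop\<^sup>t\<^sup>-\<^sup>1(w)\<close>. These
  are sets of gaps between neighbouring positions and can be written as one word over the alphabet
  of subsets of \<open>{0..<t}\<close>; for elements of \<open>B\<^sub>n\<close> they are symmetric, and half of the word, of
  length \<open>n\<close>, suffices. A permutation in the image of \<open>Pop\<close> has descending runs of length at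
  most 3, hence \<open>Pop(w)\<close> moves no entry further than a bound depending only on \<open>t\<close>, and
  whether a word comes from some \<open>w\<close> can be decided by inspecting windows of bounded size. The
  admissible words thus form a regular language.\<close>

section \<open>Counting words of a regular language\<close>

text \<open>The obstacle is the top level. The permutation \<open>w\<close> itself need not lie in
  the image of Pop, so the last of the \<open>t\<close> cut sets may have arbitrarily long blocks.
  But nothing is built on top of it: one only has to check that Pop(w), which is assembled from
  short blocks alone, increases inside each block of this set and takes a smaller value at
  \<open>l\<close> than at \<open>r\<close> whenever \<open>l\<close> and \<open>r\<close> are the
  outer ends of two blocks meeting at a cut. Reversing a short block moves an entry by at most 2, so
  this is automatic for \<open>l\<close> and \<open>r\<close> far apart and visible in a bounded
  window otherwise. That Pop reverses runs comes from recording an inversion as a pair of values: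
  right weak order becomes inclusion of inversion sets. The lower bounds of \<open>w\<close> and its
  lower neighbours are the elements whose inversion set lies in that of \<open>w\<close> and omits
  the pairs of values forming descents. Along a descending run the omission spreads by transitivity
  to all pairs of the run, and reversing the run removes exactly these.\<close>

lemma rational_fps_of_poly: "rational_fps (fps_of_poly p)"
  unfolding rational_fps_def by (rule exI[of _ p], rule exI[of _ 1]) simp

lemma rational_fps_add:
  assumes "rational_fps F" "rational_fps G"
  shows "rational_fps (F + G)"
proof -
  from assms obtain p q r s where "q \<noteq> 0" "s \<noteq> 0"
    and eqs [symmetric]: "F * fps_of_poly q = fps_of_poly p" "G * fps_of_poly s = fps_of_poly r"
    unfolding rational_fps_def by blast
  then have "q * s \<noteq> 0" "(F + G) * fps_of_poly (q * s) = fps_of_poly (p * s + r * q)"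
    by (simp_all add: fps_of_poly_add fps_of_poly_mult algebra_simps eqs)
  then show ?thesis unfolding rational_fps_def by blast
qed

lemma rational_fps_mult:
  assumes "rational_fps F" "rational_fps G"
  shows "rational_fps (F * G)"
proof -
  from assms obtain p q r s where "q \<noteq> 0" "s \<noteq> 0"
    and eqs [symmetric]: "F * fps_of_poly q = fps_of_poly p" "G * fps_of_poly s = fps_of_poly r"
    unfolding rational_fps_def by blast
  then have "q * s \<noteq> 0" "(F * G) * fps_of_poly (q * s) = fps_of_poly (p * r)"
    by (simp_all add: fps_of_poly_mult algebra_simps eqs)
  then show ?thesis unfolding rational_fps_def by blast
qed

lemma rational_fps_const: "rational_fps (fps_const c)"
  using rational_fps_of_poly[of "[:c:]"] by (simp add: fps_of_poly_const)

lemma rational_fps_sum: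
  assumes "\<And>j. j \<in> J \<Longrightarrow> rational_fps (f j)"
  shows "rational_fps (sum f J)"
  using assms rational_fps_const[of 0]
  by (induction J rule: infinite_finite_induct) (auto intro: rational_fps_add)

lemma rational_fps_X: "rational_fps fps_X"
  using rational_fps_of_poly[of "[:0, 1:]"] by (simp add: fps_of_poly_pCons)

lemma rational_fps_diff:
  assumes "rational_fps F" "rational_fps G"
  shows "rational_fps (F - G)"
  using rational_fps_add[OF assms(1) rational_fps_mult[OF rational_fps_const[of "-1"] assms(2)]]
  by (simp flip: fps_const_neg)

lemma rational_fps_inverse:
  fixes F :: "'a :: field fps"
  assumes "rational_fps F" "fps_nth F 0 \<noteq> 0"
  shows "rational_fps (inverse F)"
proof -
  from assms obtain p q where pq: "q \<noteq> 0" "F * fps_of_poly q = fps_of_poly p"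
    unfolding rational_fps_def by blast
  have "inverse F * F = 1" using assms(2) by (rule inverse_mult_eq_1)
  then have "inverse F * fps_of_poly p = fps_of_poly q"
    by (metis pq(2) mult.assoc mult_1)
  moreover have "p \<noteq> 0"
    using pq assms(2) by auto
  ultimately show ?thesis unfolding rational_fps_def by blast
qed

text \<open>Gaussian elimination: \<open>1 - fps_X * M k k\<close> has constant term 1, so the
  equation for \<open>k\<close> can be solved and substituted into the others. The entries become
  rational series even if they start as constants, hence the generality of \<open>c\<close> and
  \<open>M\<close>.\<close>

lemma rational_fps_linear_system:
  fixes G :: "'i \<Rightarrow> 'a :: field fps"
  assumes "finite I"
    and "\<And>i. i \<in> I \<Longrightarrow> rational_fps (c i)"
    and "\<And>i j. i \<in> I \<Longrightarrow> j \<in> I \<Longrightarrow> rational_fps (M i j)"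
    and "\<And>i. i \<in> I \<Longrightarrow> G i = c i + fps_X * (\<Sum>j\<in>I. M i j * G j)"
    and "i \<in> I"
  shows "rational_fps (G i)"
  using assms
proof (induction I arbitrary: c M i rule: finite_induct)
  case empty
  then show ?case by simp
next
  case (insert k I)
  define D where "D = inverse (1 - fps_X * M k k)"
  have rD: "rational_fps D"
    unfolding D_def using rational_fps_const[of 1]
    by (intro rational_fps_inverse rational_fps_diff rational_fps_mult rational_fps_X insert.prems)
       simp_all
  have D: "D * (1 - fps_X * M k k) = 1"
    unfolding D_def by (rule inverse_mult_eq_1) simp
  have "G k * (1 - fps_X * M k k) = c k + fps_X * (\<Sum>j\<in>I. M k j * G j)"
    using insert.prems(3)[of k] insert.hyps by (simp add: algebra_simps)
  then have "D * (c k + fps_X * (\<Sum>j\<in>I. M k j * G j)) = D * (1 - fps_X * M k k) * G k"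
    by (simp only: mult.assoc mult.commute[of "G k"])
  then have Gk: "G k = D * (c k + fps_X * (\<Sum>j\<in>I. M k j * G j))"
    by (simp only: D mult_1)
  define c' where "c' i = c i + fps_X * (M i k * (D * c k))" for i
  define M' where "M' i j = M i j + M i k * (D * (fps_X * M k j))" for i j
  have rI: "rational_fps (G i)" if "i \<in> I" for i
  proof (rule insert.IH[of c' M'])
    show "rational_fps (c' i)" if "i \<in> I" for i
      unfolding c'_def using that
      by (intro rational_fps_add rational_fps_mult rational_fps_X rD insert.prems) auto
    show "rational_fps (M' i j)" if "i \<in> I" "j \<in> I" for i j
      unfolding M'_def using that
      by (intro rational_fps_add rational_fps_mult rational_fps_X rD insert.prems) auto
    show "G i = c' i + fps_X * (\<Sum>j\<in>I. M' i j * G j)" if "i \<in> I" for i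
    proof -
      have "G i = c i + fps_X * (M i k * G k + (\<Sum>j\<in>I. M i j * G j))"
        using insert.prems(3)[of i] that insert.hyps by simp
      also have "\<dots> = c' i + fps_X * ((\<Sum>j\<in>I. M i j * G j)
          + M i k * (D * (fps_X * (\<Sum>j\<in>I. M k j * G j))))"
        unfolding c'_def by (subst Gk) (simp add: algebra_simps)
      also have "(\<Sum>j\<in>I. M i j * G j) + M i k * (D * (fps_X * (\<Sum>j\<in>I. M k j * G j)))
          = (\<Sum>j\<in>I. M' i j * G j)"
        unfolding M'_def by (simp add: sum_distrib_left sum.distrib algebra_simps)
      finally show ?thesis .
    qed
  qed (rule that)
  have "rational_fps (G k)"
    by (subst Gk, intro rational_fps_add rational_fps_mult rational_fps_X rD rational_fps_sum)
       (auto intro: insert.prems rI insert.hyps)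
  then show ?case using rI insert.prems(4) by auto
qed

text \<open>Left quotients of a language. By Myhill-Nerode, having finitely many of them is
  regularity, so no automaton has to be constructed.\<close>

definition residual :: "'a list set \<Rightarrow> 'a list \<Rightarrow> 'a list set"
  where "residual L u = {v. u @ v \<in> L}"

text \<open>The residuals are the states of the minimal automaton. Splitting off the first letter
  expresses the series of each state through those of its successors, a linear system with constant
  coefficients.\<close>

theorem rational_fps_finite_residuals:
  fixes L :: "'a list set"
  assumes \<Sigma>: "finite \<Sigma>" "L \<subseteq> lists \<Sigma>" and fin: "finite (range (residual L))"
  shows "rational_fps (Abs_fps (\<lambda>n. of_nat (card {x \<in> L. length x = n})) :: 'b :: field fps)"
proof -
  define G :: "'a list set \<Rightarrow> 'b fps"
    where "G X = Abs_fps (\<lambda>n. of_nat (card {x \<in> X. length x = n}))" for X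
  define I where "I = {X \<in> range (residual L). X \<subseteq> lists \<Sigma>}"
  define c :: "'a list set \<Rightarrow> 'b fps"
    where "c X = fps_const (of_nat (card {x \<in> X. length x = 0}))" for X
  define M :: "'a list set \<Rightarrow> 'a list set \<Rightarrow> 'b fps"
    where "M X Y = fps_const (of_nat (card {a \<in> \<Sigma>. residual X [a] = Y}))" for X Y
  have I_fin: "finite I" using fin unfolding I_def by auto
  have step: "residual X [a] \<in> I" if X: "X \<in> I" "a \<in> \<Sigma>" for X a
  proof -
    obtain u where u: "X = residual L u" "X \<subseteq> lists \<Sigma>" using X(1) unfolding I_def by blast
    then have "residual X [a] = residual L (u @ [a])" by (simp add: residual_def)
    moreover have "residual X [a] \<subseteq> lists \<Sigma>" using u(2) by (auto simp: residual_def)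
    ultimately show ?thesis unfolding I_def by auto
  qed
  have "G X = c X + fps_X * (\<Sum>Y\<in>I. M X Y * G Y)" if X: "X \<in> I" for X
  proof (rule fps_ext)
    fix n
    show "fps_nth (G X) n = fps_nth (c X + fps_X * (\<Sum>Y\<in>I. M X Y * G Y)) n"
    proof (cases n)
      case 0
      then show ?thesis by (simp add: G_def c_def)
    next
      case (Suc m)
      have "{x \<in> X. length x = Suc m}
          = (\<Union>a\<in>\<Sigma>. (\<lambda>v. a # v) ` {v \<in> residual X [a]. length v = m})"
      proof -
        have "a \<in> \<Sigma>" if "a # v \<in> X" for a v using X that unfolding I_def by auto
        then show ?thesis by (auto simp: residual_def length_Suc_conv)
      qed
      moreover have "finite {v \<in> residual X [a]. length v = m}" if "a \<in> \<Sigma>" for a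
        by (rule finite_subset[OF _ finite_lists_length_eq[OF \<Sigma>(1), of m]])
           (use step[OF X that] in \<open>auto simp: I_def\<close>)
      ultimately have "card {x \<in> X. length x = Suc m}
          = (\<Sum>a\<in>\<Sigma>. card {v \<in> residual X [a]. length v = m})"
        using \<Sigma>(1) by (simp only:) (subst card_UN_disjoint; auto intro!: sum.cong card_image inj_onI)
      then have "fps_nth (G X) (Suc m) = (\<Sum>a\<in>\<Sigma>. fps_nth (G (residual X [a])) m)"
        by (simp add: G_def)
      also have "\<dots> = (\<Sum>Y\<in>I. \<Sum>a\<in>{a \<in> \<Sigma>. residual X [a] = Y}. fps_nth (G (residual X [a])) m)"
        using \<Sigma>(1) I_fin step[OF X] by (intro sum.group[symmetric]) auto
      also have "\<dots> = (\<Sum>Y\<in>I. of_nat (card {a \<in> \<Sigma>. residual X [a] = Y}) * fps_nth (G Y) m)"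
        by (intro sum.cong) auto
      finally show ?thesis
        by (simp add: Suc c_def M_def fps_sum_nth)
    qed
  qed
  moreover have "L \<in> I"
    using \<Sigma>(2) unfolding I_def by (auto simp: residual_def intro!: range_eqI[of _ _ "[]"])
  ultimately have "rational_fps (G L)"
    by (intro rational_fps_linear_system[OF I_fin, of c M G]) (auto simp: c_def M_def rational_fps_const)
  then show ?thesis by (simp add: G_def)
qed

section \<open>Languages of reflected words defined by local conditions\<close>

text \<open>The word \<open>x\<^sub>0 \<dots> x\<^sub>n\<^sub>-\<^sub>1\<close> stands for the bi-infinite word
  \<open>\<dots> d x\<^sub>n\<^sub>-\<^sub>1 \<dots> x\<^sub>1 x\<^sub>0 x\<^sub>1 \<dots> x\<^sub>n\<^sub>-\<^sub>1 d \<dots>\<close>.\<close>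

definition reflect_word :: "'a \<Rightarrow> 'a list \<Rightarrow> int \<Rightarrow> 'a"
  where "reflect_word d x g = (if nat \<bar>g\<bar> < length x then x ! nat \<bar>g\<bar> else d)"

text \<open>The positions \<open>i\<close> and \<open>i'\<close> may differ, so locality includes
  translation invariance; this allows the end of a long word to be moved to the front.\<close>

definition local_pred :: "nat \<Rightarrow> ((int \<Rightarrow> 'a) \<Rightarrow> int \<Rightarrow> bool) \<Rightarrow> bool"
  where "local_pred K Q \<longleftrightarrow> (\<forall>f i f' i'.
    (\<forall>h. \<bar>h\<bar> \<le> int K \<longrightarrow> f (i + h) = f' (i' + h)) \<longrightarrow> Q f i = Q f' i')"

lemma reflect_word_minus: "reflect_word d x (- g) = reflect_word d x g"
  by (simp add: reflect_word_def)

text \<open>A prefix \<open>u\<close> is either short, or already violates a condition whose window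
  lies inside it, or else matters only through its last \<open>2 * K\<close> letters: the first
  position still open is \<open>length u - K\<close>, and its window starts \<open>K\<close> letters
  earlier.\<close>

lemma finite_residuals_local_half:
  assumes \<Sigma>: "finite \<Sigma>" and loc: "local_pred K Q"
  shows "finite (range (residual {x \<in> lists \<Sigma>. \<forall>i\<ge>0. Q (reflect_word d x) i}))"
    (is "finite (range (residual ?L))")
proof -
  \<comment> \<open>Starting at \<open>K\<close> keeps all windows at nonnegative positions, so the
    reflection, which would be that of \<open>s @ v\<close> instead of \<open>u @ v\<close>, is
    never seen.\<close>
  define R where "R s = {v \<in> lists \<Sigma>. \<forall>i\<ge>int K. Q (reflect_word d (s @ v)) i}" for s
  have "residual ?L u \<in> residual ?L ` {u \<in> lists \<Sigma>. length u \<le> 2 * K} \<union> {{}}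
      \<union> R ` {s \<in> lists \<Sigma>. length s = 2 * K}" for u
  proof (cases "u \<in> lists \<Sigma> \<and> length u > 2 * K
      \<and> (\<forall>i\<ge>0. i + int K < int (length u) \<longrightarrow> Q (reflect_word d u) i)")
    case True
    define m where "m = length u - 2 * K"
    define s where "s = drop m u"
    have len: "length u = 2 * K + m" "length s = 2 * K" using True by (auto simp: m_def s_def)
    have "residual ?L u = R s"
    proof (rule Set.set_eqI)
      fix v
      have near: "Q (reflect_word d (u @ v)) i = Q (reflect_word d u) i"
        if "i \<ge> 0" "i + int K < int (length u)" for i
        by (rule loc[unfolded local_pred_def, rule_format])
           (use that True in \<open>auto simp: reflect_word_def nth_append\<close>)
      have far: "Q (reflect_word d (u @ v)) i = Q (reflect_word d (s @ v)) (i - int m)"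
        if "i \<ge> int m + int K" for i
      proof (rule loc[unfolded local_pred_def, rule_format])
        fix h :: int assume h: "\<bar>h\<bar> \<le> int K"
        define p where "p = nat (i - int m + h)"
        have p: "i + h = int (m + p)" "i - int m + h = int p" using h that by (auto simp: p_def)
        have "(u @ v) ! (m + p) = (s @ v) ! p"
          using len by (auto simp: nth_append s_def)
        then show "reflect_word d (u @ v) (i + h) = reflect_word d (s @ v) (i - int m + h)"
          unfolding p reflect_word_def abs_of_nat nat_int using len by simp
      qed
      have split: "(\<forall>i\<ge>0. Q (reflect_word d (u @ v)) i)
          \<longleftrightarrow> (\<forall>i\<ge>int K. Q (reflect_word d (s @ v)) i)"
      proof (intro iffI allI impI)
        fix i assume "\<forall>i\<ge>0. Q (reflect_word d (u @ v)) i" "i \<ge> int K"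
        then show "Q (reflect_word d (s @ v)) i" using far[of "i + int m"] by simp
      next
        fix i :: int assume *: "\<forall>i\<ge>int K. Q (reflect_word d (s @ v)) i" "i \<ge> 0"
        show "Q (reflect_word d (u @ v)) i"
        proof (cases "i + int K < int (length u)")
          case True then show ?thesis using near[of i] * \<open>u \<in> _ \<and> _\<close> by simp
        next
          case False
          then show ?thesis using far[of i] * len by simp
        qed
      qed
      show "v \<in> residual ?L u \<longleftrightarrow> v \<in> R s"
        using split True by (auto simp: residual_def R_def)
    qed
    moreover have "s \<in> lists \<Sigma>" using True by (auto simp: s_def dest: in_set_dropD)
    ultimately show ?thesis using len by auto
  next
    case False
    then consider "u \<notin> lists \<Sigma>" | "u \<in> lists \<Sigma>" "length u \<le> 2 * K"
      | i where "i \<ge> 0" "i + int K < int (length u)" "\<not> Q (reflect_word d u) i"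
      by force
    then show ?thesis
    proof cases
      case 1 then show ?thesis by (auto simp: residual_def)
    next
      case 2 then show ?thesis by auto
    next
      case 3
      have "\<not> Q (reflect_word d (u @ v)) i" for v
      proof -
        have "Q (reflect_word d (u @ v)) i = Q (reflect_word d u) i"
        proof (rule loc[unfolded local_pred_def, rule_format])
          fix h :: int assume "\<bar>h\<bar> \<le> int K"
          then have "nat \<bar>i + h\<bar> < length u" using 3 by linarith
          then show "reflect_word d (u @ v) (i + h) = reflect_word d u (i + h)"
            by (simp add: reflect_word_def nth_append)
        qed
        with 3 show ?thesis by simp
      qed
      then have "residual ?L u = {}" using 3(1) by (auto simp: residual_def)
      then show ?thesis by simp
    qed
  qed
  then have "range (residual ?L) \<subseteq> residual ?L ` {u \<in> lists \<Sigma>. length u \<le> 2 * K} \<union> {{}}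
      \<union> R ` {s \<in> lists \<Sigma>. length s = 2 * K}" by blast
  moreover have "finite {u \<in> lists \<Sigma>. length u \<le> 2 * K}" "finite {u \<in> lists \<Sigma>. length u = 2 * K}"
    using finite_lists_length_le[OF \<Sigma>] finite_lists_length_eq[OF \<Sigma>]
    by (simp_all add: lists_eq_set)
  ultimately show ?thesis by (meson finite.emptyI finite.insertI finite_UnI finite_imageI finite_subset)
qed

text \<open>A reflected word is even, so a condition at a negative position is the mirrored
  condition at a nonnegative one; \<open>Q'\<close> imposes both.\<close>

lemma finite_residuals_local:
  assumes \<Sigma>: "finite \<Sigma>" and loc: "local_pred K Q"
  shows "finite (range (residual {x \<in> lists \<Sigma>. \<forall>i. Q (reflect_word d x) i}))"
proof -
  define Q' where "Q' f i \<longleftrightarrow> Q f i \<and> Q (\<lambda>g. f (- g)) (- i)" for f i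
  have "local_pred K Q'"
    unfolding local_pred_def
  proof (intro allI impI)
    fix f f' :: "int \<Rightarrow> 'a" and i i'
    assume *: "\<forall>h. \<bar>h\<bar> \<le> int K \<longrightarrow> f (i + h) = f' (i' + h)"
    have "Q f i = Q f' i'"
      using * by (intro loc[unfolded local_pred_def, rule_format]) auto
    moreover have "Q (\<lambda>g. f (- g)) (- i) = Q (\<lambda>g. f' (- g)) (- i')"
      using *[rule_format, of "- _"] by (intro loc[unfolded local_pred_def, rule_format]) simp
    ultimately show "Q' f i = Q' f' i'" by (simp add: Q'_def)
  qed
  moreover have "(\<forall>i. Q (reflect_word d x) i) \<longleftrightarrow> (\<forall>i\<ge>0. Q' (reflect_word d x) i)" for x
    unfolding Q'_def reflect_word_minus by (metis minus_minus neg_0_le_iff_le nle_le)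
  ultimately show ?thesis using finite_residuals_local_half[OF \<Sigma>] by simp
qed

section \<open>Pop as the reversal of descending runs\<close>

text \<open>A set \<open>A\<close> of integers cuts the integers into blocks, \<open>g \<in> A\<close> being a cut between
  \<open>g\<close> and \<open>g + 1\<close>. Here \<open>{l..r}\<close> is the block of \<open>p\<close>.\<close>

definition is_block :: "int set \<Rightarrow> int \<Rightarrow> int \<Rightarrow> int \<Rightarrow> bool"
  where "is_block A p l r \<longleftrightarrow> l \<le> p \<and> p \<le> r \<and> l - 1 \<in> A \<and> r \<in> A \<and> (\<forall>g. l \<le> g \<and> g < r \<longrightarrow> g \<notin> A)"

definition block_rev :: "int set \<Rightarrow> int \<Rightarrow> int"
  where "block_rev A p = (THE q. \<exists>l r. is_block A p l r \<and> q = l + r - p)"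

text \<open>Ensures that every position lies in a finite block, so that the description in
  \<open>block_rev\<close> denotes.\<close>

definition unbounded_cuts :: "int set \<Rightarrow> bool"
  where "unbounded_cuts A \<longleftrightarrow> (\<forall>p. (\<exists>a\<in>A. a < p) \<and> (\<exists>a\<in>A. p \<le> a))"

lemma is_block_unique:
  assumes "is_block A p l r" "is_block A p l' r'"
  shows "l = l'" "r = r'"
proof -
  have "r \<le> r'" "r' \<le> r" "l \<le> l'" "l' \<le> l"
    using assms unfolding is_block_def by (smt (verit))+
  then show "l = l'" "r = r'" by auto
qed

lemma is_block_exists:
  assumes "unbounded_cuts A"
  obtains l r where "is_block A p l r"
proof -
  have r: "\<exists>k. p + int k \<in> A"
  proof -
    obtain a where "a \<in> A" "p \<le> a" using assms unfolding unbounded_cuts_def by blast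
    then show ?thesis by (intro exI[of _ "nat (a - p)"]) simp
  qed
  have l: "\<exists>k. p - 1 - int k \<in> A"
  proof -
    obtain a where "a \<in> A" "a < p" using assms unfolding unbounded_cuts_def by blast
    then show ?thesis by (intro exI[of _ "nat (p - 1 - a)"]) simp
  qed
  define kr where "kr = (LEAST k. p + int k \<in> A)"
  define kl where "kl = (LEAST k. p - 1 - int k \<in> A)"
  have "p + int kr \<in> A" "p - 1 - int kl \<in> A"
    using LeastI_ex[OF r] LeastI_ex[OF l] by (simp_all add: kr_def kl_def)
  moreover have "g \<notin> A" if "p - int kl \<le> g" "g < p + int kr" for g
  proof (cases "p \<le> g")
    case True
    then show ?thesis
      using not_less_Least[of "nat (g - p)" "\<lambda>k. p + int k \<in> A"] that by (auto simp: kr_def)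
  next
    case False
    then show ?thesis
      using not_less_Least[of "nat (p - 1 - g)" "\<lambda>k. p - 1 - int k \<in> A"] that
      by (auto simp: kl_def)
  qed
  ultimately have "is_block A p (p - int kl) (p + int kr)"
    by (auto simp: is_block_def algebra_simps)
  then show ?thesis by (rule that)
qed

lemma block_rev_eq:
  assumes "is_block A p l r"
  shows "block_rev A p = l + r - p"
  unfolding block_rev_def using assms is_block_unique[OF assms] by (intro the_equality) blast+

lemma is_block_mem:
  assumes "is_block A p l r" "l \<le> q" "q \<le> r"
  shows "is_block A q l r"
  using assms unfolding is_block_def by auto

lemma block_rev_block_rev:
  assumes "unbounded_cuts A"
  shows "block_rev A (block_rev A p) = p"
proof -
  obtain l r where b: "is_block A p l r" using is_block_exists[OF assms] .
  then have "l \<le> p" "p \<le> r" by (auto simp: is_block_def)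
  then have "is_block A (l + r - p) l r" using is_block_mem[OF b] by simp
  with b show ?thesis by (simp add: block_rev_eq)
qed

lemma block_rev_less_same:
  assumes "unbounded_cuts A" "p < q" "\<And>g. p \<le> g \<Longrightarrow> g < q \<Longrightarrow> g \<notin> A"
  shows "block_rev A q < block_rev A p"
proof -
  obtain l r where b: "is_block A p l r" using is_block_exists[OF assms(1)] .
  moreover from this have "q \<le> r" using assms(3)[of r] by (auto simp: is_block_def)
  moreover have "l \<le> q" using b assms(2) by (auto simp: is_block_def)
  ultimately have "is_block A q l r" using is_block_mem by blast
  with b show ?thesis using assms(2) by (simp add: block_rev_eq)
qed

lemma block_rev_less_diff:
  assumes "unbounded_cuts A" "p \<le> g" "g < q" "g \<in> A"
  shows "block_rev A p < block_rev A q"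
proof -
  obtain l r where b: "is_block A p l r" using is_block_exists[OF assms(1)] .
  obtain l' r' where b': "is_block A q l' r'" using is_block_exists[OF assms(1)] .
  have "r \<le> g" "g < l'"
    using b b' assms(2-4) unfolding is_block_def by (smt (verit))+
  then show ?thesis using b b' by (auto simp: block_rev_eq) (auto simp: is_block_def)
qed

text \<open>With all gaps from \<open>n\<close> on outwards cut, positions outside
  \<open>{1-n..n}\<close> are singleton blocks and are fixed by \<open>block_rev\<close>; evenness
  is compatibility with the mirror \<open>p\<close> to \<open>1 - p\<close>.\<close>

definition sym_cuts :: "nat \<Rightarrow> int set \<Rightarrow> bool"
  where "sym_cuts n A \<longleftrightarrow> (\<forall>g. - g \<in> A \<longleftrightarrow> g \<in> A) \<and> (\<forall>g. int n \<le> \<bar>g\<bar> \<longrightarrow> g \<in> A)"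

lemma sym_cuts_unbounded:
  assumes "sym_cuts n A"
  shows "unbounded_cuts A"
  unfolding unbounded_cuts_def
proof (intro allI conjI)
  fix p
  have "- \<bar>p\<bar> - int n - 1 \<in> A" "\<bar>p\<bar> + int n \<in> A" using assms by (auto simp: sym_cuts_def)
  then show "\<exists>a\<in>A. a < p" "\<exists>a\<in>A. p \<le> a" by (force intro: bexI[rotated])+
qed

lemma block_rev_sym:
  assumes "sym_cuts n A"
  shows "block_rev A (1 - p) = 1 - block_rev A p"
proof -
  obtain l r where b: "is_block A p l r" using is_block_exists[OF sym_cuts_unbounded[OF assms]] .
  have sym: "- g \<in> A \<longleftrightarrow> g \<in> A" for g using assms by (simp add: sym_cuts_def)
  have "is_block A (1 - p) (1 - r) (1 - l)"
    unfolding is_block_def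
  proof (intro conjI allI impI)
    show "1 - r - 1 \<in> A" "1 - l \<in> A" using b sym[of r] sym[of "l - 1"] by (auto simp: is_block_def)
    fix g assume "1 - r \<le> g \<and> g < 1 - l"
    then show "g \<notin> A" using b sym[of g] by (auto simp: is_block_def)
  qed (use b in \<open>auto simp: is_block_def\<close>)
  then show ?thesis using b by (simp add: block_rev_eq)
qed

text \<open>The hyperoctahedral group, with the positions \<open>{1..2n}\<close> shifted to \<open>{1-n..n}\<close>: then
  the gap between positions \<open>g\<close> and \<open>g + 1\<close> is mirrored to the gap between \<open>-g\<close> and \<open>1 - g\<close>.\<close>

definition signed_perms :: "nat \<Rightarrow> (int \<Rightarrow> int) set"
  where "signed_perms n = {w. w permutes {1 - int n..int n} \<and> (\<forall>p. w (1 - p) = 1 - w p)}"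

definition ascents :: "(int \<Rightarrow> int) \<Rightarrow> int set"
  where "ascents w = {g. w g < w (g + 1)}"

definition run_rev :: "(int \<Rightarrow> int) \<Rightarrow> int \<Rightarrow> int"
  where "run_rev w = w \<circ> block_rev (ascents w)"

lemma signed_perms_permutes: "w \<in> signed_perms n \<Longrightarrow> w permutes {1 - int n..int n}"
  by (simp add: signed_perms_def)

lemma signed_perms_sym: "w \<in> signed_perms n \<Longrightarrow> w (1 - p) = 1 - w p"
  by (simp add: signed_perms_def)

lemma signed_perms_inj: "w \<in> signed_perms n \<Longrightarrow> inj w"
  by (auto simp: signed_perms_def permutes_inj)

lemma signed_perms_id: "id \<in> signed_perms n"
  by (simp add: signed_perms_def permutes_id)

lemma signed_perms_comp: "v \<in> signed_perms n \<Longrightarrow> w \<in> signed_perms n \<Longrightarrow> v \<circ> w \<in> signed_perms n"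
  by (auto simp: signed_perms_def intro: permutes_compose)

lemma block_rev_signed_perms:
  assumes "sym_cuts n A"
  shows "block_rev A \<in> signed_perms n"
proof -
  have "block_rev A p = p" if "p \<notin> {1 - int n..int n}" for p
  proof -
    have "is_block A p p p" using assms that by (auto simp: is_block_def sym_cuts_def)
    then show ?thesis by (simp add: block_rev_eq)
  qed
  moreover have "\<exists>!p. block_rev A p = q" for q
    using block_rev_block_rev[OF sym_cuts_unbounded[OF assms]] by metis
  ultimately show ?thesis
    unfolding signed_perms_def permutes_def using block_rev_sym[OF assms] by blast
qed

text \<open>At gap \<open>n\<close> a value at most \<open>n\<close> meets the fixed value
  \<open>n + 1\<close>, and similarly at \<open>- n\<close>; further out \<open>w\<close> is the
  identity.\<close>

lemma ascents_sym_cuts: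
  assumes w: "w \<in> signed_perms n"
  shows "sym_cuts n (ascents w)"
proof -
  have "- g \<in> ascents w \<longleftrightarrow> g \<in> ascents w" for g
    using signed_perms_sym[OF w, of g] signed_perms_sym[OF w, of "g + 1"]
    by (simp add: ascents_def)
  moreover have "g \<in> ascents w" if "int n \<le> \<bar>g\<bar>" for g
  proof -
    have mem: "w p \<in> {1 - int n..int n} \<longleftrightarrow> p \<in> {1 - int n..int n}" for p
      using permutes_in_image[OF signed_perms_permutes[OF w]] .
    have fix': "w p = p" if "p \<notin> {1 - int n..int n}" for p
      using permutes_not_in[OF signed_perms_permutes[OF w] that] .
    show ?thesis
      using mem[of g] mem[of "g + 1"] fix'[of g] fix'[of "g + 1"] that
      unfolding ascents_def mem_Collect_eq atLeastAtMost_iff by (smt (verit))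
  qed
  ultimately show ?thesis by (simp add: sym_cuts_def)
qed

lemma run_rev_signed_perms: "w \<in> signed_perms n \<Longrightarrow> run_rev w \<in> signed_perms n"
  unfolding run_rev_def by (intro signed_perms_comp block_rev_signed_perms ascents_sym_cuts)

lemma funpow_run_rev_signed_perms: "w \<in> signed_perms n \<Longrightarrow> (run_rev ^^ k) w \<in> signed_perms n"
  by (induction k) (auto intro: run_rev_signed_perms)

lemma not_ascent:
  assumes "inj w" "g \<notin> ascents w"
  shows "w (g + 1) < w g"
  using assms injD[OF assms(1), of g "g + 1"] by (auto simp: ascents_def not_less order_le_less)

text \<open>Reversing a descending run leaves only ascents inside it, so a new descent can occur
  only where two runs meet.\<close>

lemma descent_of_run_rev:
  assumes "inj w" "unbounded_cuts (ascents w)" "g \<notin> ascents (run_rev w)"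
  shows "g \<in> ascents w"
proof (rule ccontr)
  let ?A = "ascents w"
  assume g: "g \<notin> ?A"
  obtain l r where b: "is_block ?A g l r" using is_block_exists[OF assms(2)] .
  then have "g + 1 \<le> r" using g by (force simp: is_block_def order_le_less)
  then have b': "is_block ?A (g + 1) l r" using is_block_mem[OF b] b by (auto simp: is_block_def)
  have "l + r - (g + 1) \<notin> ?A" using b b' by (auto simp: is_block_def)
  then have "w (l + r - (g + 1) + 1) < w (l + r - (g + 1))" by (rule not_ascent[OF assms(1)])
  also have "l + r - (g + 1) + 1 = l + r - g" by simp
  finally have "run_rev w g < run_rev w (g + 1)"
    by (simp only: run_rev_def comp_apply block_rev_eq[OF b] block_rev_eq[OF b'])
  with assms(3) show False by (simp add: ascents_def)
qed

text \<open>Three consecutive descents would consist of cuts of the previous permutation, so the two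
  middle entries would not have been moved although they formed an ascent.\<close>

lemma run_rev_short_runs:
  assumes "inj w" "unbounded_cuts (ascents w)"
  shows "g \<in> ascents (run_rev w) \<or> g + 1 \<in> ascents (run_rev w) \<or> g + 2 \<in> ascents (run_rev w)"
proof (rule ccontr)
  let ?A = "ascents w"
  assume "\<not> ?thesis"
  then have cuts: "g \<in> ?A" "g + 1 \<in> ?A" "g + 2 \<in> ?A" and desc: "g + 1 \<notin> ascents (run_rev w)"
    using descent_of_run_rev[OF assms] by auto
  have "is_block ?A (g + 1) (g + 1) (g + 1)" "is_block ?A (g + 2) (g + 2) (g + 2)"
    using cuts by (auto simp: is_block_def algebra_simps)
  then have "run_rev w (g + 1) = w (g + 1)" "run_rev w (g + 2) = w (g + 2)"
    by (simp_all add: run_rev_def block_rev_eq)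
  then show False using cuts(2) desc by (simp add: ascents_def add.commute)
qed

text \<open>Decides whether \<open>u\<close> has a preimage under run reversal with ascent set
  \<open>A\<close>. Each block must become decreasing, so \<open>u\<close> increases on it; after
  the reversal the entries facing each other across the cut \<open>i\<close> are those from the
  outer ends \<open>l\<close> and \<open>r\<close>.\<close>

lemma ascents_comp_block_rev:
  assumes "inj u" and A: "unbounded_cuts A"
  shows "ascents (u \<circ> block_rev A) = A \<longleftrightarrow>
    (\<forall>i. i \<notin> A \<longrightarrow> u i < u (i + 1)) \<and>
    (\<forall>i\<in>A. \<forall>l r. is_block A i l i \<longrightarrow> is_block A (i + 1) (i + 1) r \<longrightarrow> u l < u r)"
    (is "?L \<longleftrightarrow> ?R1 \<and> ?R2")
proof -
  let ?v = "u \<circ> block_rev A"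
  have "inj (block_rev A)" using block_rev_block_rev[OF A] by (metis injI)
  then have v: "inj ?v" using assms(1) by (intro inj_compose)
  \<comment> \<open>The reversal of \<open>{l..r}\<close> carries the inner gap \<open>i\<close> to
    the inner gap \<open>i' = l + r - (i + 1)\<close> with its two sides exchanged.\<close>
  have inner: "\<exists>i'. i' \<notin> A \<and> block_rev A i = i' + 1
      \<and> block_rev A (i + 1) = i' \<and> block_rev A i' = i + 1 \<and> block_rev A (i' + 1) = i"
    if "i \<notin> A" for i
  proof -
    obtain l r where b: "is_block A i l r" using is_block_exists[OF A] .
    then have "l \<le> i" "i < r" using that by (auto simp: is_block_def order_le_less)
    then have blocks: "is_block A q l r" if "l \<le> q" "q \<le> r" for q using is_block_mem[OF b that] by simp
    have rev: "block_rev A q = l + r - q" if "l \<le> q" "q \<le> r" for q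
      using block_rev_eq[OF blocks[OF that]] .
    have "l + r - (i + 1) \<notin> A" using \<open>l \<le> i\<close> \<open>i < r\<close> b by (auto simp: is_block_def)
    then show ?thesis
      using \<open>l \<le> i\<close> \<open>i < r\<close> by (intro exI[of _ "l + r - (i + 1)"]) (simp add: rev)
  qed
  have 1: "(\<forall>i. i \<notin> A \<longrightarrow> i \<notin> ascents ?v) \<longleftrightarrow> ?R1"
  proof (intro iffI allI impI)
    fix i assume *: "\<forall>i. i \<notin> A \<longrightarrow> i \<notin> ascents ?v" and "i \<notin> A"
    then obtain i' where "i' \<notin> A" "block_rev A i' = i + 1" "block_rev A (i' + 1) = i"
      using inner by blast
    then show "u i < u (i + 1)" using * not_ascent[OF v, of i'] by simp
  next
    fix i assume *: ?R1 and "i \<notin> A"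
    then obtain i' where "i' \<notin> A" "block_rev A i = i' + 1" "block_rev A (i + 1) = i'"
      using inner by blast
    then show "i \<notin> ascents ?v" using * by (auto simp: ascents_def not_less order.strict_implies_order)
  qed
  have 2: "i \<in> ascents ?v \<longleftrightarrow>
      (\<forall>l r. is_block A i l i \<longrightarrow> is_block A (i + 1) (i + 1) r \<longrightarrow> u l < u r)" if "i \<in> A" for i
  proof -
    obtain l r where b: "is_block A i l r" using is_block_exists[OF A] .
    obtain l' r' where b': "is_block A (i + 1) l' r'" using is_block_exists[OF A] .
    have eq: "r = i" "l' = i + 1"
      using b b' that unfolding is_block_def by (smt (verit))+
    have "i \<in> ascents ?v \<longleftrightarrow> u l < u r'"
      using b b' unfolding eq by (simp add: ascents_def block_rev_eq)
    then show ?thesis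
      using b b' unfolding eq by (metis is_block_unique)
  qed
  have "?L \<longleftrightarrow> (\<forall>i. i \<notin> A \<longrightarrow> i \<notin> ascents ?v) \<and> (\<forall>i\<in>A. i \<in> ascents ?v)" by blast
  with 1 2 show ?thesis by simp
qed

section \<open>Coding the iterated preimages of the identity by cuts\<close>

text \<open>\<open>build m j\<close> undoes \<open>j\<close> pops starting from the identity; the permutation reached
  after step \<open>i\<close> is supposed to have ascent set \<open>m i\<close>.\<close>

fun build :: "(nat \<Rightarrow> int set) \<Rightarrow> nat \<Rightarrow> int \<Rightarrow> int"
  where "build m 0 = id"
  | "build m (Suc j) = build m j \<circ> block_rev (m j)"

definition word_cuts :: "(int \<Rightarrow> nat set) \<Rightarrow> nat \<Rightarrow> int set"
  where "word_cuts f j = {g. j \<in> f g}"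

text \<open>The padding letter \<open>{..<t}\<close> makes every gap beyond the word a cut on all
  levels, as \<open>sym_cuts\<close> demands.\<close>

abbreviation cuts_of :: "nat \<Rightarrow> nat set list \<Rightarrow> nat \<Rightarrow> int set"
  where "cuts_of t x \<equiv> word_cuts (reflect_word {..<t} x)"

lemma build_signed_perms:
  assumes "\<And>i. i < j \<Longrightarrow> sym_cuts n (m i)"
  shows "build m j \<in> signed_perms n"
  using assms
  by (induction j) (auto intro: signed_perms_id signed_perms_comp block_rev_signed_perms)

lemma sym_cuts_word: "j < t \<Longrightarrow> sym_cuts (length x) (cuts_of t x j)"
  by (auto simp: sym_cuts_def word_cuts_def reflect_word_def)

definition pop_words :: "nat \<Rightarrow> nat set list set"
  where "pop_words t = {x \<in> lists (Pow {..<t}). \<forall>j<t. ascents (build (cuts_of t x) (Suc j)) = cuts_of t x j}"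

lemma run_rev_build:
  assumes "unbounded_cuts (m j)" "ascents (build m (Suc j)) = m j"
  shows "run_rev (build m (Suc j)) = build m j"
  using assms(2) block_rev_block_rev[OF assms(1)] by (simp add: run_rev_def fun_eq_iff)

lemma funpow_run_rev_build:
  assumes "\<And>j. j < t \<Longrightarrow> unbounded_cuts (m j)" "\<And>j. j < t \<Longrightarrow> ascents (build m (Suc j)) = m j"
    and "k \<le> t"
  shows "(run_rev ^^ k) (build m t) = build m (t - k)"
  using assms(3)
proof (induction k)
  case 0
  then show ?case by simp
next
  case (Suc k)
  then have "build m (t - k) = build m (Suc (t - Suc k))" by (simp add: Suc_diff_Suc)
  moreover have "run_rev (build m (Suc (t - Suc k))) = build m (t - Suc k)"
    using Suc.prems by (intro run_rev_build assms(1,2)) simp_all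
  ultimately show ?case using Suc by (simp del: build.simps)
qed

text \<open>Levels are counted from the identity upwards, as in \<open>build\<close>, hence the
  exponent \<open>t - Suc j\<close>; the top level \<open>t - 1\<close> belongs to \<open>w\<close>
  itself. Gap 0 is the central one, and the negative gaps follow by symmetry.\<close>

definition word_of_perm :: "nat \<Rightarrow> nat \<Rightarrow> (int \<Rightarrow> int) \<Rightarrow> nat set list"
  where "word_of_perm t n w =
    map (\<lambda>i. {j. j < t \<and> int i \<in> ascents ((run_rev ^^ (t - Suc j)) w)}) [0..<n]"

lemma cuts_of_word_of_perm:
  assumes "w \<in> signed_perms n" "j < t"
  shows "cuts_of t (word_of_perm t n w) j = ascents ((run_rev ^^ (t - Suc j)) w)"
    (is "_ = ?A")
proof (rule Set.set_eqI)
  fix g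
  have sym: "sym_cuts n ?A"
    by (intro ascents_sym_cuts funpow_run_rev_signed_perms assms(1))
  then have "g \<in> ?A \<longleftrightarrow> \<bar>g\<bar> \<in> ?A" by (auto simp: sym_cuts_def abs_if)
  moreover have "\<bar>g\<bar> \<in> ?A" if "n \<le> nat \<bar>g\<bar>" using sym that by (auto simp: sym_cuts_def)
  ultimately show "g \<in> cuts_of t (word_of_perm t n w) j \<longleftrightarrow> g \<in> ?A"
    using assms(2) by (auto simp: word_cuts_def reflect_word_def word_of_perm_def)
qed

lemma build_word_of_perm:
  assumes w: "w \<in> signed_perms n" "(run_rev ^^ t) w = id" and "j \<le> t"
  shows "build (cuts_of t (word_of_perm t n w)) j = (run_rev ^^ (t - j)) w"
  using assms(3)
proof (induction j)
  case 0
  then show ?case using w by simp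
next
  case (Suc j)
  let ?u = "(run_rev ^^ (t - Suc j)) w"
  have "unbounded_cuts (ascents ?u)"
    by (intro sym_cuts_unbounded[of n] ascents_sym_cuts funpow_run_rev_signed_perms w)
  moreover have "t - j = Suc (t - Suc j)" using Suc.prems by simp
  then have "(run_rev ^^ (t - j)) w = ?u \<circ> block_rev (ascents ?u)"
    by (simp add: run_rev_def)
  ultimately show ?case
    using Suc cuts_of_word_of_perm[OF w(1), of j t] by (auto simp: fun_eq_iff block_rev_block_rev)
qed

lemma card_signed_perms_pop_words:
  "card {w \<in> signed_perms n. (run_rev ^^ t) w = id} = card {x \<in> pop_words t. length x = n}"
proof (rule bij_betw_same_card, rule bij_betw_byWitness)
  let ?W = "{w \<in> signed_perms n. (run_rev ^^ t) w = id}" and ?X = "{x \<in> pop_words t. length x = n}"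
  show "\<forall>w\<in>?W. build (cuts_of t (word_of_perm t n w)) t = w"
    by (auto simp: build_word_of_perm)
  show "word_of_perm t n ` ?W \<subseteq> ?X"
  proof clarify
    fix w assume w: "w \<in> signed_perms n" "(run_rev ^^ t) w = id"
    have "ascents (build (cuts_of t (word_of_perm t n w)) (Suc j)) = cuts_of t (word_of_perm t n w) j"
      if "j < t" for j
      using build_word_of_perm[OF w, of "Suc j"] cuts_of_word_of_perm[OF w(1), of j t] that
      by (simp del: build.simps)
    moreover have "word_of_perm t n w \<in> lists (Pow {..<t})" by (auto simp: word_of_perm_def)
    ultimately show "word_of_perm t n w \<in> pop_words t \<and> length (word_of_perm t n w) = n"
      by (simp add: pop_words_def word_of_perm_def del: build.simps)
  qed
  have *: "build (cuts_of t x) t \<in> ?W \<and> word_of_perm t n (build (cuts_of t x) t) = x"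
    if x: "x \<in> pop_words t" "length x = n" for x
  proof -
    let ?m = "cuts_of t x"
    have sym: "sym_cuts n (?m j)" if "j < t" for j using sym_cuts_word[OF that] x(2) by blast
    have asc: "ascents (build ?m (Suc j)) = ?m j" if "j < t" for j
      using x(1) that by (simp add: pop_words_def del: build.simps)
    have pow: "(run_rev ^^ k) (build ?m t) = build ?m (t - k)" if "k \<le> t" for k
      using that sym asc by (intro funpow_run_rev_build sym_cuts_unbounded) auto
    have "word_of_perm t n (build ?m t) = x"
    proof (rule nth_equalityI)
      show "length (word_of_perm t n (build ?m t)) = length x" using x(2) by (simp add: word_of_perm_def)
      fix i assume "i < length (word_of_perm t n (build ?m t))"
      then have i: "i < n" by (simp add: word_of_perm_def)
      have "j < t" if "j \<in> x ! i" for j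
        using x i that nth_mem[of i x] unfolding pop_words_def by (auto simp: in_lists_conv_set)
      moreover have "ascents ((run_rev ^^ (t - Suc j)) (build ?m t)) = ?m j" if "j < t" for j
        using pow[of "t - Suc j"] asc[OF that] that by (simp del: build.simps)
      moreover have "int i \<in> ?m j \<longleftrightarrow> j \<in> x ! i" for j
        using i x(2) by (simp add: word_cuts_def reflect_word_def)
      ultimately show "word_of_perm t n (build ?m t) ! i = x ! i"
        using i by (auto simp: word_of_perm_def)
    qed
    moreover have "build ?m t \<in> signed_perms n" by (rule build_signed_perms) (rule sym)
    ultimately show ?thesis using pow[of t] by simp
  qed
  then show "\<forall>x\<in>?X. word_of_perm t n (build (cuts_of t x) t) = x"
    "(\<lambda>x. build (cuts_of t x) t) ` ?X \<subseteq> ?W" by blast+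
qed

section \<open>Locality of the coding\<close>

text \<open>Block reversal for blocks of size at most 3, decided by the gaps from
  \<open>p - 2\<close> to \<open>p + 1\<close>. Unlike \<open>block_rev\<close> it is local and of
  bounded displacement for every \<open>A\<close> whatsoever.\<close>

definition block_rev3 :: "int set \<Rightarrow> int \<Rightarrow> int"
  where "block_rev3 A p =
    (if p - 1 \<in> A then (if p \<in> A then p else if p + 1 \<in> A then p + 1 else p + 2)
     else if p \<in> A then (if p - 2 \<in> A then p - 1 else p - 2) else p)"

lemma block_rev_eq_block_rev3:
  assumes "\<And>g. g \<in> A \<or> g + 1 \<in> A \<or> g + 2 \<in> A"
  shows "block_rev A = block_rev3 A"
proof
  fix p
  consider "p - 1 \<in> A" "p \<in> A" | "p - 1 \<in> A" "p \<notin> A" "p + 1 \<in> A"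
    | "p - 1 \<in> A" "p \<notin> A" "p + 1 \<notin> A" "p + 2 \<in> A"
    | "p - 1 \<notin> A" "p \<in> A" "p - 2 \<in> A" | "p - 1 \<notin> A" "p \<in> A" "p - 2 \<notin> A" "p - 3 \<in> A"
    | "p - 1 \<notin> A" "p \<notin> A" "p - 2 \<in> A" "p + 1 \<in> A"
    using assms[of p] assms[of "p - 1"] assms[of "p - 2"] assms[of "p - 3"]
    by (auto simp: algebra_simps)
  then show "block_rev A p = block_rev3 A p"
  proof cases
    case 1
    then have "is_block A p p p" by (auto simp: is_block_def)
    with 1 show ?thesis by (simp add: block_rev_eq block_rev3_def)
  next
    case 2
    then have "is_block A p p (p + 1)" by (auto simp: is_block_def dest: order_antisym)
    with 2 show ?thesis by (simp add: block_rev_eq block_rev3_def)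
  next
    case 3
    then have "is_block A p p (p + 2)"
      unfolding is_block_def by (smt (verit))
    with 3 show ?thesis by (simp add: block_rev_eq block_rev3_def)
  next
    case 4
    then have "is_block A p (p - 1) p" unfolding is_block_def by (smt (verit))
    with 4 show ?thesis by (simp add: block_rev_eq block_rev3_def)
  next
    case 5
    then have "is_block A p (p - 2) p" unfolding is_block_def by (smt (verit))
    with 5 show ?thesis by (simp add: block_rev_eq block_rev3_def)
  next
    case 6
    then have "is_block A p (p - 1) (p + 1)" unfolding is_block_def by (smt (verit))
    with 6 show ?thesis by (simp add: block_rev_eq block_rev3_def)
  qed
qed

fun build3 :: "(nat \<Rightarrow> int set) \<Rightarrow> nat \<Rightarrow> int \<Rightarrow> int"
  where "build3 m 0 = id"
  | "build3 m (Suc j) = build3 m j \<circ> block_rev3 (m j)"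

lemma block_rev3_displacement: "\<bar>block_rev3 A p - p\<bar> \<le> 2"
  by (simp add: block_rev3_def)

lemma build3_displacement: "\<bar>build3 m j p - p\<bar> \<le> 2 * int j"
proof (induction j arbitrary: p)
  case (Suc j)
  from Suc[of "block_rev3 (m j) p"] block_rev3_displacement[of "m j" p] show ?case
    by (simp add: abs_le_iff)
qed simp

text \<open>Each of the \<open>j\<close> levels inspects gaps at distance at most 2 and moves the
  position by at most 2. Comparing displacements rather than values makes the claim translation
  invariant.\<close>

lemma build3_local:
  assumes "\<And>i h. i < j \<Longrightarrow> \<bar>h\<bar> \<le> 2 * int j \<Longrightarrow> p + h \<in> m i \<longleftrightarrow> p' + h \<in> m' i"
  shows "build3 m j p - p = build3 m' j p' - p'"
  using assms
proof (induction j arbitrary: p p')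
  case (Suc j)
  define d where "d = block_rev3 (m j) p - p"
  have agree: "p + h \<in> m j \<longleftrightarrow> p' + h \<in> m' j" if "\<bar>h\<bar> \<le> 2" for h
    using Suc.prems[of j h] that by simp
  have d': "block_rev3 (m' j) p' - p' = d"
    using agree[of 0] agree[of 1] agree[of "-1"] agree[of 2] agree[of "-2"]
    unfolding d_def block_rev3_def by simp
  have "build3 m j (p + d) - (p + d) = build3 m' j (p' + d) - (p' + d)"
  proof (rule Suc.IH)
    fix i h assume "i < j" "\<bar>h\<bar> \<le> 2 * int j"
    then show "p + d + h \<in> m i \<longleftrightarrow> p' + d + h \<in> m' i"
      using Suc.prems[of i "d + h"] block_rev3_displacement[of "m j" p]
      by (simp add: d_def[symmetric] add.assoc)
  qed
  moreover have "block_rev3 (m j) p = p + d" "block_rev3 (m' j) p' = p' + d"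
    using d_def d' by simp_all
  ultimately show ?case by simp
qed simp

lemma is_block_local:
  assumes "\<And>h. l - 1 \<le> h \<Longrightarrow> h \<le> r \<Longrightarrow> i + h \<in> A \<longleftrightarrow> i' + h \<in> A'" and "l \<le> r"
  shows "is_block A (i + c) (i + l) (i + r) \<longleftrightarrow> is_block A' (i' + c) (i' + l) (i' + r)"
proof -
  have "(\<forall>g. i + l \<le> g \<and> g < i + r \<longrightarrow> g \<notin> A) \<longleftrightarrow> (\<forall>h. l \<le> h \<and> h < r \<longrightarrow> i + h \<notin> A)" for A i
    by (metis add.commute add_le_cancel_left add_less_cancel_left diff_add_cancel)
  moreover have "i + l - 1 \<in> A \<longleftrightarrow> i' + l - 1 \<in> A'" "i + r \<in> A \<longleftrightarrow> i' + r \<in> A'"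
    using assms(1)[of "l - 1"] assms(1)[of r] assms(2) by (simp_all add: add_diff_eq)
  moreover have "(\<forall>h. l \<le> h \<and> h < r \<longrightarrow> i + h \<notin> A) \<longleftrightarrow> (\<forall>h. l \<le> h \<and> h < r \<longrightarrow> i' + h \<notin> A')"
    using assms(1) by auto
  ultimately show ?thesis unfolding is_block_def by simp
qed

text \<open>The bounds on \<open>a\<close> and \<open>b\<close> are harmless: \<^const>\<open>build3\<close> moves no element by more than
  \<open>2j\<close>, so entries further apart are in increasing order anyway.\<close>

definition pop_local :: "nat \<Rightarrow> (nat \<Rightarrow> int set) \<Rightarrow> nat \<Rightarrow> int \<Rightarrow> bool"
  where "pop_local t m j i \<longleftrightarrow>
    (i \<notin> m j \<longrightarrow> build3 m j i < build3 m j (i + 1)) \<and>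
    (i \<in> m j \<longrightarrow> (\<forall>a b. 0 \<le> a \<longrightarrow> a \<le> 4 * int t \<longrightarrow> 0 \<le> b \<longrightarrow> b \<le> 4 * int t \<longrightarrow>
        is_block (m j) i (i - a) i \<longrightarrow> is_block (m j) (i + 1) (i + 1) (i + 1 + b) \<longrightarrow>
        build3 m j (i - a) < build3 m j (i + 1 + b))) \<and>
    (Suc j < t \<longrightarrow> i \<in> m j \<or> i + 1 \<in> m j \<or> i + 2 \<in> m j)"

text \<open>The last reversal uses \<open>block_rev\<close>, not \<open>block_rev3\<close>, because
  on the top level \<open>j = t - 1\<close> the blocks may be long.\<close>

lemma ascents_build3_iff:
  assumes "j < t" and A: "unbounded_cuts (m j)" and u: "inj (build3 m j)"
  shows "ascents (build3 m j \<circ> block_rev (m j)) = m j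
      \<and> (Suc j < t \<longrightarrow> (\<forall>i. i \<in> m j \<or> i + 1 \<in> m j \<or> i + 2 \<in> m j))
    \<longleftrightarrow> (\<forall>i. pop_local t m j i)"
proof -
  let ?u = "build3 m j"
  have "(\<forall>l r. is_block (m j) i l i \<longrightarrow> is_block (m j) (i + 1) (i + 1) r \<longrightarrow> ?u l < ?u r) \<longleftrightarrow>
    (\<forall>a b. 0 \<le> a \<longrightarrow> a \<le> 4 * int t \<longrightarrow> 0 \<le> b \<longrightarrow> b \<le> 4 * int t \<longrightarrow>
        is_block (m j) i (i - a) i \<longrightarrow> is_block (m j) (i + 1) (i + 1) (i + 1 + b) \<longrightarrow>
        ?u (i - a) < ?u (i + 1 + b))" (is "?L \<longleftrightarrow> ?R") for i
  proof
    assume R: ?R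
    show ?L
    proof (intro allI impI)
      fix l r assume b: "is_block (m j) i l i" "is_block (m j) (i + 1) (i + 1) r"
      then have le: "l \<le> i" "i + 1 \<le> r" by (auto simp: is_block_def)
      show "?u l < ?u r"
      proof (cases "i - l \<le> 4 * int t \<and> r - (i + 1) \<le> 4 * int t")
        case True
        then show ?thesis using R[rule_format, of "i - l" "r - (i + 1)"] b le by simp
      next
        case False
        then show ?thesis
          using build3_displacement[of m j l] build3_displacement[of m j r] le assms(1) by linarith
      qed
    qed
  qed blast
  then show ?thesis
    unfolding ascents_comp_block_rev[OF u A] pop_local_def by blast
qed

lemma build_eq_build3:
  assumes "\<And>i. i < j \<Longrightarrow> (\<forall>g. g \<in> m i \<or> g + 1 \<in> m i \<or> g + 2 \<in> m i)"
  shows "build m j = build3 m j"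
  using assms by (induction j) (simp_all add: block_rev_eq_block_rev3)

text \<open>The left side says nothing about block sizes, but below the top level it implies the
  bound: there \<open>m j\<close> is the ascent set of
  \<open>run_rev (build m (Suc (Suc j)))\<close>, so \<open>run_rev_short_runs\<close> applies. On
  the right the bound is part of \<open>pop_local\<close>. Once it is known, \<open>build\<close>
  and \<open>build3\<close> agree.\<close>

lemma valid_cuts_iff_pop_local:
  assumes sym: "\<And>j. j < t \<Longrightarrow> sym_cuts n (m j)"
  shows "(\<forall>j<t. ascents (build m (Suc j)) = m j) \<longleftrightarrow> (\<forall>i. \<forall>j<t. pop_local t m j i)"
    (is "?L \<longleftrightarrow> ?R")
proof -
  note A = sym_cuts_unbounded[OF sym]
  let ?short = "\<forall>j. Suc j < t \<longrightarrow> (\<forall>i. i \<in> m j \<or> i + 1 \<in> m j \<or> i + 2 \<in> m j)"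
  have short: ?short if L: ?L
  proof (intro allI impI)
    fix j i assume j: "Suc j < t"
    let ?w = "build m (Suc (Suc j))"
    have w: "?w \<in> signed_perms n" using j by (intro build_signed_perms sym) simp
    have "ascents (run_rev ?w) = m j"
      using run_rev_build[of m "Suc j"] A[of "Suc j"] L j by (metis Suc_lessD)
    then show "i \<in> m j \<or> i + 1 \<in> m j \<or> i + 2 \<in> m j"
      using run_rev_short_runs[of ?w i] signed_perms_inj[OF w]
        sym_cuts_unbounded[OF ascents_sym_cuts[OF w]] by metis
  qed
  have "?short \<and> ?L \<longleftrightarrow> ?short \<and> ?R"
  proof (rule conj_cong[OF refl])
    assume ?short
    then have eq: "build m j = build3 m j" if "j < t" for j
      using that by (intro build_eq_build3) simp
    have inj: "inj (build3 m j)" if "j < t" for j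
      unfolding eq[OF that, symmetric] using that sym
      by (intro signed_perms_inj[of _ n] build_signed_perms) simp
    show "?L \<longleftrightarrow> ?R"
      using ascents_build3_iff[OF _ A inj] \<open>?short\<close> eq by simp blast
  qed
  moreover have ?short if ?R using that by (auto simp: pop_local_def)
  ultimately show ?thesis using short by blast
qed

text \<open>\<open>build3\<close> is evaluated at distance at most \<open>4 * t + 1\<close> from
  \<open>i\<close> and looks at most \<open>2 * j\<close> further, with \<open>j < t\<close>; the
  radius \<open>6 * t + 3\<close> covers this.\<close>

lemma pop_local_local:
  assumes "\<And>k h. k < t \<Longrightarrow> \<bar>h\<bar> \<le> 6 * int t + 3 \<Longrightarrow> i + h \<in> m k \<longleftrightarrow> i' + h \<in> m' k" and "j < t"
  shows "pop_local t m j i \<longleftrightarrow> pop_local t m' j i'"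
proof -
  have agree: "i + h \<in> m j \<longleftrightarrow> i' + h \<in> m' j" if "\<bar>h\<bar> \<le> 6 * int t + 3" for h
    using assms that by blast
  have build: "build3 m j (i + c) = build3 m' j (i' + c) + (i - i')" if "\<bar>c\<bar> \<le> 4 * int t + 1" for c
  proof -
    have "build3 m j (i + c) - (i + c) = build3 m' j (i' + c) - (i' + c)"
    proof (rule build3_local)
      fix k h assume "k < j" "\<bar>h\<bar> \<le> 2 * int j"
      then show "i + c + h \<in> m k \<longleftrightarrow> i' + c + h \<in> m' k"
        using assms(1)[of k "c + h"] assms(2) that by (simp add: add.assoc)
    qed
    then show ?thesis by simp
  qed
  have "(i \<notin> m j \<longrightarrow> build3 m j i < build3 m j (i + 1))
      \<longleftrightarrow> (i' \<notin> m' j \<longrightarrow> build3 m' j i' < build3 m' j (i' + 1))"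
    using build[of 0] build[of 1] agree[of 0] by simp
  moreover have "i \<in> m j \<longleftrightarrow> i' \<in> m' j" "i + 1 \<in> m j \<longleftrightarrow> i' + 1 \<in> m' j" "i + 2 \<in> m j \<longleftrightarrow> i' + 2 \<in> m' j"
    using agree[of 0] agree[of 1] agree[of 2] by simp_all
  moreover have "(is_block (m j) i (i - a) i \<longrightarrow> is_block (m j) (i + 1) (i + 1) (i + 1 + b) \<longrightarrow>
        build3 m j (i - a) < build3 m j (i + 1 + b)) \<longleftrightarrow>
      (is_block (m' j) i' (i' - a) i' \<longrightarrow> is_block (m' j) (i' + 1) (i' + 1) (i' + 1 + b) \<longrightarrow>
        build3 m' j (i' - a) < build3 m' j (i' + 1 + b))"
    if "0 \<le> a" "a \<le> 4 * int t" "0 \<le> b" "b \<le> 4 * int t" for a b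
  proof -
    have "is_block (m j) (i + 0) (i + - a) (i + 0) \<longleftrightarrow> is_block (m' j) (i' + 0) (i' + - a) (i' + 0)"
      by (rule is_block_local; use that in \<open>auto intro!: agree\<close>)
    moreover have "is_block (m j) (i + 1) (i + 1) (i + (1 + b))
        \<longleftrightarrow> is_block (m' j) (i' + 1) (i' + 1) (i' + (1 + b))"
      by (rule is_block_local; use that in \<open>auto intro!: agree\<close>)
    ultimately show ?thesis
      using build[of "- a"] build[of "1 + b"] that by (simp add: add.assoc)
  qed
  ultimately show ?thesis unfolding pop_local_def by blast
qed

lemma finite_residuals_pop_words: "finite (range (residual (pop_words t)))"
proof -
  have eq: "pop_words t = {x \<in> lists (Pow {..<t}). \<forall>i. \<forall>j<t. pop_local t (cuts_of t x) j i}"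
    unfolding pop_words_def
    by (intro Collect_cong conj_cong refl valid_cuts_iff_pop_local) (rule sym_cuts_word)
  have loc: "local_pred (6 * t + 3) (\<lambda>f i. \<forall>j<t. pop_local t (word_cuts f) j i)"
    unfolding local_pred_def
  proof (intro allI impI all_cong)
    fix f i f' i' j
    assume "\<forall>h. \<bar>h\<bar> \<le> int (6 * t + 3) \<longrightarrow> f (i + h) = (f' (i' + h) :: nat set)" "j < t"
    then show "pop_local t (word_cuts f) j i \<longleftrightarrow> pop_local t (word_cuts f') j i'"
      by (intro pop_local_local) (auto simp: word_cuts_def)
  qed
  show ?thesis unfolding eq by (rule finite_residuals_local[OF _ loc]) simp
qed

theorem rational_fps_signed_perms:
  "rational_fps (Abs_fps (\<lambda>n. of_nat (card {w \<in> signed_perms n. (run_rev ^^ t) w = id})) :: rat fps)"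
  unfolding card_signed_perms_pop_words
  by (rule rational_fps_finite_residuals[OF _ _ finite_residuals_pop_words, of "Pow {..<t}"])
     (auto simp: pop_words_def)

section \<open>Inversions and length\<close>

text \<open>Inversions are pairs of values: right multiplication by a generator swaps neighbouring
  positions and so adds or removes pairs without relabelling the others.\<close>

definition inv_set :: "(int \<Rightarrow> int) \<Rightarrow> (int \<times> int) set"
  where "inv_set w = {(a, b). a < b \<and> inv' w b < inv' w a}"

text \<open>A reflection of the hyperoctahedral group inverts either a pair \<open>{a, 1 - a}\<close> or two
  mirrored pairs; the weights make both cases count twice.\<close>

definition weight :: "int \<times> int \<Rightarrow> nat"
  where "weight = (\<lambda>(a, b). if a + b = 1 then 2 else 1)"

definition wlen :: "(int \<Rightarrow> int) \<Rightarrow> nat"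
  where "wlen w = sum weight (inv_set w)"

text \<open>The simple reflection swapping \<open>g\<close> with \<open>g + 1\<close> and also their
  mirror images. For \<open>g = 0\<close> the two swaps coincide, and \<open>- g\<close> gives the
  same map as \<open>g\<close>.\<close>

definition sgen :: "int \<Rightarrow> int \<Rightarrow> int"
  where "sgen g p = (if p = g then g + 1 else if p = g + 1 then g
    else if p = - g then 1 - g else if p = 1 - g then - g else p)"

lemma weight_nonzero: "weight ab \<noteq> 0"
  by (simp add: weight_def split: prod.split)

lemma inv_signed_perms [simp]:
  assumes "w \<in> signed_perms n"
  shows "inv' w (w p) = p" "w (inv' w p) = p"
  using permutes_inverses[OF signed_perms_permutes[OF assms]] by auto

lemma inv_in_signed_perms:
  assumes w: "w \<in> signed_perms n"
  shows "inv' w \<in> signed_perms n"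
proof -
  have "inv' w (1 - p) = 1 - inv' w p" for p
    using signed_perms_sym[OF w, of "inv' w p"] w by (metis inv_signed_perms)
  then show ?thesis
    using permutes_inv[OF signed_perms_permutes[OF w]] by (simp add: signed_perms_def)
qed

lemma inv_comp_signed_perms:
  assumes "v \<in> signed_perms n" "w \<in> signed_perms n"
  shows "inv' (v \<circ> w) = inv' w \<circ> inv' v"
  using assms by (intro o_inv_distrib permutes_bij) (auto intro: signed_perms_permutes)

text \<open>Mirror pairs go to mirror pairs, so relabelling by \<open>w\<close> preserves
  \<open>weight\<close>.\<close>

lemma signed_perms_sum_one_iff:
  assumes w: "w \<in> signed_perms n"
  shows "w a + w b = 1 \<longleftrightarrow> a + b = 1"
proof -
  have "w a + w b = 1 \<longleftrightarrow> w b = w (1 - a)" using signed_perms_sym[OF w] by auto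
  also have "\<dots> \<longleftrightarrow> b = 1 - a" using signed_perms_inj[OF w] by (simp add: inj_eq)
  finally show ?thesis by auto
qed

lemma finite_inv_set:
  assumes w: "w \<in> signed_perms n"
  shows "finite (inv_set w)"
proof (rule finite_subset)
  let ?v = "inv' w" and ?I = "{1 - int n..int n}"
  have v: "?v permutes ?I" by (intro signed_perms_permutes inv_in_signed_perms w)
  have mem: "?v p \<in> ?I \<longleftrightarrow> p \<in> ?I" for p using permutes_in_image[OF v] .
  have out: "p \<notin> ?I \<Longrightarrow> ?v p = p" for p using permutes_not_in[OF v] .
  show "inv_set w \<subseteq> ?I \<times> ?I"
  proof clarify
    fix a b assume "(a, b) \<in> inv_set w"
    then show "a \<in> ?I \<and> b \<in> ?I"
      using mem[of a] mem[of b] out[of a] out[of b]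
      unfolding inv_set_def atLeastAtMost_iff mem_Collect_eq prod.case by (smt (verit))
  qed
qed simp

lemma inv_set_id: "inv_set id = {}"
  by (auto simp: inv_set_def)

lemma descent_in_inv_set:
  assumes w: "w \<in> signed_perms n" and "g \<notin> ascents w"
  shows "(w (g + 1), w g) \<in> inv_set w"
  using not_ascent[OF signed_perms_inj[OF w] assms(2)] w by (simp add: inv_set_def)

lemma signed_perms_no_descents:
  assumes w: "w \<in> signed_perms n" and asc: "\<And>g. g \<in> ascents w"
  shows "w = id"
proof -
  \<comment> \<open>Going left from the fixed point \<open>n + 1\<close>, an everywhere ascending
    \<open>w\<close> drops by at least 1 at each step. The mirror symmetry then yields the opposite
    inequality.\<close>
  have le: "w p \<le> p" for p
  proof (cases "p \<le> int n + 1")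
    case True
    then show ?thesis
    proof (induction p rule: int_le_induct)
      case base
      then show ?case using permutes_not_in[OF signed_perms_permutes[OF w], of "int n + 1"] by simp
    next
      case (step i)
      then show ?case using asc[of "i - 1"] by (simp add: ascents_def)
    qed
  next
    case False
    then show ?thesis using permutes_not_in[OF signed_perms_permutes[OF w], of p] by simp
  qed
  have "p \<le> w p" for p using le[of "1 - p"] signed_perms_sym[OF w, of p] by simp
  with le show ?thesis by (auto simp: fun_eq_iff intro: order_antisym)
qed

lemma wlen_0:
  assumes w: "w \<in> signed_perms n" and "wlen w = 0"
  shows "w = id"
proof -
  have "inv_set w = {}"
    using assms(2) finite_inv_set[OF w] weight_nonzero by (fastforce simp: wlen_def)
  then show ?thesis using signed_perms_no_descents[OF w] descent_in_inv_set[OF w] by blast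
qed

section \<open>The simple generators and their effect on inversions\<close>

lemma sgen_sgen: "sgen g (sgen g p) = p"
  by (auto simp: sgen_def)

lemma inv_sgen: "inv' (sgen g) = sgen g"
  by (rule inv_unique_comp) (auto simp: fun_eq_iff sgen_sgen)

lemma sgen_signed_perms:
  assumes "\<bar>g\<bar> < int n"
  shows "sgen g \<in> signed_perms n"
proof -
  have "sgen g p = p" if "p \<notin> {1 - int n..int n}" for p
    using assms that by (auto simp: sgen_def)
  moreover have "\<exists>!p. sgen g p = q" for q using sgen_sgen by metis
  moreover have "sgen g (1 - p) = 1 - sgen g p" for p unfolding sgen_def by presburger
  ultimately show ?thesis unfolding signed_perms_def permutes_def by blast
qed

lemma sgen_less_iff:
  assumes "p \<noteq> q"
  shows "sgen g q < sgen g p \<longleftrightarrow>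
    q < p \<and> (q, p) \<notin> {(g, g + 1), (- g, 1 - g)} \<or> (p, q) \<in> {(g, g + 1), (- g, 1 - g)}"
proof -
  \<comment> \<open>By parity \<open>g + 1\<close> differs from \<open>- g\<close>, so the two
    swapped pairs are either equal or disjoint.\<close>
  have "2 * g + 1 \<noteq> 0" by presburger
  then show ?thesis using assms unfolding sgen_def by (smt (verit) Pair_inject empty_iff insert_iff)
qed

lemma inv_set_comp_sgen:
  assumes w: "w \<in> signed_perms n" and g: "\<bar>g\<bar> < int n"
  shows "(a, b) \<in> inv_set (w \<circ> sgen g) \<longleftrightarrow> a < b \<and>
    ((a, b) \<in> inv_set w \<and> (a, b) \<notin> {(w (g + 1), w g), (w (1 - g), w (- g))}
      \<or> (a, b) \<in> {(w g, w (g + 1)), (w (- g), w (1 - g))})"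
proof -
  let ?p = "inv' w a" and ?q = "inv' w b"
  have inv_eq: "inv' w c = p \<longleftrightarrow> c = w p" for c p using w by auto
  have "?p \<noteq> ?q" if "a < b" using that w by (metis inv_signed_perms(2) less_irrefl)
  then show ?thesis
    unfolding inv_set_def inv_comp_signed_perms[OF w sgen_signed_perms[OF g]] inv_sgen
    using sgen_less_iff[of ?p ?q g] by (auto simp: inv_eq)
qed

lemma neg_ascents:
  assumes w: "w \<in> signed_perms n"
  shows "- g \<in> ascents w \<longleftrightarrow> g \<in> ascents w"
  using ascents_sym_cuts[OF w] by (simp add: sym_cuts_def)

lemma descent_bound:
  assumes "w \<in> signed_perms n" "g \<notin> ascents w"
  shows "\<bar>g\<bar> < int n"
  using ascents_sym_cuts[OF assms(1)] assms(2) unfolding sym_cuts_def by (meson not_le)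

lemma inv_set_comp_sgen_descent:
  assumes w: "w \<in> signed_perms n" and g: "\<bar>g\<bar> < int n" and "g \<notin> ascents w"
  shows "inv_set (w \<circ> sgen g) = inv_set w - {(w (g + 1), w g), (w (1 - g), w (- g))}"
proof -
  have "w (g + 1) < w g" "w (- g + 1) < w (- g)"
    using not_ascent[OF signed_perms_inj[OF w]] assms(3) neg_ascents[OF w] by blast+
  then have desc: "w (g + 1) < w g" "w (1 - g) < w (- g)" by simp_all
  have "(a, b) \<in> inv_set (w \<circ> sgen g) \<longleftrightarrow>
      (a, b) \<in> inv_set w - {(w (g + 1), w g), (w (1 - g), w (- g))}" for a b
  proof -
    have "(a, b) \<in> inv_set w \<Longrightarrow> a < b" by (simp add: inv_set_def)
    moreover have "(a, b) \<in> {(w g, w (g + 1)), (w (- g), w (1 - g))} \<Longrightarrow> \<not> a < b"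
      using desc by auto
    ultimately show ?thesis
      unfolding inv_set_comp_sgen[OF w g] by blast
  qed
  then show ?thesis by (intro Set.set_eqI) (metis surj_pair)
qed

lemma wlen_comp_sgen_ascent:
  assumes w: "w \<in> signed_perms n" and g: "\<bar>g\<bar> < int n" and "g \<in> ascents w"
  shows "wlen (w \<circ> sgen g) = wlen w + 2"
proof -
  let ?E = "{(w g, w (g + 1)), (w (- g), w (1 - g))}"
  have asc: "w g < w (g + 1)" "w (- g) < w (1 - g)"
    using assms(3) neg_ascents[OF w, of g] by (auto simp: ascents_def)
  have "(a, b) \<in> inv_set (w \<circ> sgen g) \<longleftrightarrow> (a, b) \<in> inv_set w \<union> ?E" for a b
  proof -
    have "(a, b) \<in> inv_set w \<Longrightarrow> a < b" by (simp add: inv_set_def)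
    moreover have "(a, b) \<in> ?E \<Longrightarrow> a < b"
      "(a, b) \<in> {(w (g + 1), w g), (w (1 - g), w (- g))} \<Longrightarrow> \<not> a < b"
      using asc by auto
    ultimately show ?thesis
      unfolding inv_set_comp_sgen[OF w g] by blast
  qed
  then have "inv_set (w \<circ> sgen g) = inv_set w \<union> ?E"
    by (intro Set.set_eqI) (metis surj_pair)
  moreover have "inv_set w \<inter> ?E = {}" using w by (auto simp: inv_set_def)
  \<comment> \<open>For \<open>g = 0\<close> the two new inversions coincide in one mirror pair of
    weight 2; otherwise they are distinct and of weight 1.\<close>
  moreover have "sum weight ?E = 2"
  proof (cases "g = 0")
    case True
    then show ?thesis using signed_perms_sym[OF w, of 0] by (simp add: weight_def)
  next
    case False
    have "w g \<noteq> w (- g)" using False signed_perms_inj[OF w] by (simp add: inj_eq)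
    then show ?thesis
      using False signed_perms_sum_one_iff[OF w, of g "g + 1"] signed_perms_sum_one_iff[OF w, of "- g" "1 - g"]
      by (simp add: weight_def)
  qed
  ultimately show ?thesis
    unfolding wlen_def
    by (simp only: sum.union_disjoint[OF finite_inv_set[OF w]] finite.emptyI finite.insertI)
qed

lemma wlen_comp_sgen_descent:
  assumes w: "w \<in> signed_perms n" and g: "\<bar>g\<bar> < int n" and "g \<notin> ascents w"
  shows "wlen w = wlen (w \<circ> sgen g) + 2"
proof -
  have "g \<in> ascents (w \<circ> sgen g)"
    using not_ascent[OF signed_perms_inj[OF w] assms(3)] by (simp add: ascents_def sgen_def)
  moreover have "w \<circ> sgen g \<circ> sgen g = w" by (simp add: fun_eq_iff sgen_sgen)
  ultimately show ?thesis
    using wlen_comp_sgen_ascent[OF signed_perms_comp[OF w sgen_signed_perms[OF g]] g] by simp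
qed

text \<open>Relabelled by \<open>x\<close>, the inversions of \<open>inv' x \<circ> y\<close> are
  the pairs of values that \<open>x\<close> and \<open>y\<close> order differently. Since
  \<open>x\<close> may exchange the two members of a pair, \<open>f\<close> sorts them
  again.\<close>

lemma wlen_inv_comp:
  assumes x: "x \<in> signed_perms n" and y: "y \<in> signed_perms n"
  shows "wlen (inv' x \<circ> y) = sum weight ((inv_set x - inv_set y) \<union> (inv_set y - inv_set x))"
proof -
  define f where "f z = (\<lambda>(a, b). (min (z a) (z b), max (z a) (z b)))" for z :: "int \<Rightarrow> int"
  let ?u = "inv' x \<circ> y" and ?D = "(inv_set x - inv_set y) \<union> (inv_set y - inv_set x)"
  have inv_u: "inv' ?u = inv' y \<circ> x"
    using inv_comp_signed_perms[OF inv_in_signed_perms[OF x] y]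
    by (simp add: inv_inv_eq permutes_bij[OF signed_perms_permutes[OF x]])
  have neq: "x a \<noteq> x b" "inv' x a \<noteq> inv' x b" "inv' y a \<noteq> inv' y b" if "a \<noteq> b" for a b
    using that x y signed_perms_inj[OF x] signed_perms_inj[OF inv_in_signed_perms[OF x]]
      signed_perms_inj[OF inv_in_signed_perms[OF y]] by (auto simp: inj_eq)
  have "sum weight (inv_set ?u) = sum weight ?D"
  proof (rule sum.reindex_bij_witness[of _ "f (inv' x)" "f x"])
    fix ab assume "ab \<in> inv_set ?u"
    then obtain a b where ab: "ab = (a, b)" "a < b" "inv' y (x b) < inv' y (x a)"
      unfolding inv_set_def inv_u by auto
    show "f (inv' x) (f x ab) = ab"
      using ab x by (auto simp: f_def min_def max_def)
    show "f x ab \<in> ?D"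
      using ab x neq(1)[of a b] by (auto simp: f_def inv_set_def min_def max_def)
    show "weight (f x ab) = weight ab"
      using ab signed_perms_sum_one_iff[OF x, of a b]
      by (auto simp: f_def weight_def min_def max_def add.commute)
  next
    fix cd assume cd': "cd \<in> ?D"
    then obtain c d where cd: "cd = (c, d)" "c < d" by (auto simp: inv_set_def)
    show "f x (f (inv' x) cd) = cd"
      using cd x by (auto simp: f_def min_def max_def)
    show "f (inv' x) cd \<in> inv_set ?u"
      using cd cd' x neq(2,3)[of c d] unfolding inv_set_def inv_u
      by (auto simp: f_def min_def max_def)
  qed
  then show ?thesis by (simp add: wlen_def)
qed

text \<open>The left side is the defining equation of right weak order. Its first term is the weight
  of the symmetric difference, so equality forces the part of \<open>inv_set x\<close> outside
  \<open>inv_set y\<close> to have weight 0.\<close>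

lemma inv_set_subset_iff:
  assumes x: "x \<in> signed_perms n" and y: "y \<in> signed_perms n"
  shows "int (wlen (inv' x \<circ> y)) = int (wlen y) - int (wlen x) \<longleftrightarrow> inv_set x \<subseteq> inv_set y"
proof -
  let ?X = "inv_set x" and ?Y = "inv_set y"
  have fin: "finite ?X" "finite ?Y" using finite_inv_set x y by blast+
  have "wlen (inv' x \<circ> y) = sum weight (?X - ?Y) + sum weight (?Y - ?X)"
    unfolding wlen_inv_comp[OF x y] using fin by (intro sum.union_disjoint) auto
  moreover have "wlen x = sum weight (?X - ?Y) + sum weight (?X \<inter> ?Y)"
    unfolding wlen_def using fin sum.Int_Diff[of ?X weight ?Y] by simp
  moreover have "wlen y = sum weight (?Y - ?X) + sum weight (?X \<inter> ?Y)"
    unfolding wlen_def using fin sum.Int_Diff[of ?Y weight ?X] by (simp add: Int_commute)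
  ultimately have "int (wlen (inv' x \<circ> y)) = int (wlen y) - int (wlen x) \<longleftrightarrow> sum weight (?X - ?Y) = 0"
    by linarith
  also have "\<dots> \<longleftrightarrow> ?X - ?Y = {}"
    by (subst sum_eq_0_iff) (use fin weight_nonzero in blast)+
  finally show ?thesis by blast
qed

lemma inv_set_inject:
  assumes x: "x \<in> signed_perms n" and y: "y \<in> signed_perms n" and "inv_set x = inv_set y"
  shows "x = y"
proof -
  have "inv' x \<circ> y = id"
    using wlen_inv_comp[OF x y] assms(3)
    by (intro wlen_0[OF signed_perms_comp[OF inv_in_signed_perms[OF x] y]]) simp
  then have "x (inv' x (y p)) = x p" for p by (simp add: fun_eq_iff)
  then show ?thesis using x by (simp add: fun_eq_iff)
qed

section \<open>The reversal of descending runs as a meet\<close>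

lemma descending_run:
  assumes "inj w" "p < q" "\<And>g. p \<le> g \<Longrightarrow> g < q \<Longrightarrow> g \<notin> ascents w"
  shows "w q < w p"
  using assms(2,3)
proof (induction q rule: int_gr_induct)
  case base
  then show ?case using not_ascent[OF assms(1), of p] by simp
next
  case (step i)
  then show ?case using not_ascent[OF assms(1), of i] by (force intro: order_less_trans)
qed

lemma inv_run_rev:
  assumes w: "w \<in> signed_perms n"
  shows "inv' (run_rev w) = block_rev (ascents w) \<circ> inv' w"
proof -
  note A = ascents_sym_cuts[OF w]
  have "inv' (block_rev (ascents w)) = block_rev (ascents w)"
    by (rule inv_unique_comp) (auto simp: fun_eq_iff block_rev_block_rev[OF sym_cuts_unbounded[OF A]])
  then show ?thesis
    unfolding run_rev_def inv_comp_signed_perms[OF w block_rev_signed_perms[OF A]] by simp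
qed

text \<open>Only positions in a common block change their relative order, and there \<open>w\<close>
  was decreasing; inversions can only disappear.\<close>

lemma inv_set_run_rev_subset:
  assumes w: "w \<in> signed_perms n"
  shows "inv_set (run_rev w) \<subseteq> inv_set w"
proof clarify
  fix a b assume ab: "(a, b) \<in> inv_set (run_rev w)"
  let ?A = "ascents w" and ?p = "inv' w a" and ?q = "inv' w b"
  note A = sym_cuts_unbounded[OF ascents_sym_cuts[OF w]]
  have *: "a < b" "block_rev ?A ?q < block_rev ?A ?p"
    using ab by (auto simp: inv_set_def inv_run_rev[OF w])
  have "\<not> ?p < ?q"
  proof
    assume less: "?p < ?q"
    have "g \<notin> ?A" if "?p \<le> g" "g < ?q" for g
      using block_rev_less_diff[OF A that] * by auto
    then have "w ?q < w ?p" by (rule descending_run[OF signed_perms_inj[OF w] less])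
    then show False using * w by simp
  qed
  moreover have "?p \<noteq> ?q" using *(2) by auto
  ultimately show "(a, b) \<in> inv_set w" using * by (simp add: inv_set_def)
qed

lemma descent_notin_inv_set_run_rev:
  assumes w: "w \<in> signed_perms n" and "g \<notin> ascents w"
  shows "(w (g + 1), w g) \<notin> inv_set (run_rev w)"
proof -
  have "block_rev (ascents w) (g + 1) < block_rev (ascents w) g"
    using assms(2) by (intro block_rev_less_same sym_cuts_unbounded[OF ascents_sym_cuts[OF w]])
      (auto dest: order_antisym)
  then show ?thesis using w by (simp add: inv_set_def inv_run_rev[OF w])
qed

text \<open>The maximality behind the meet: if \<open>x\<close> inverts no descent pair of
  \<open>w\<close>, then by transitivity it inverts no pair from a single run. Its inversions thus
  join different runs of \<open>w\<close>, and these survive the reversal.\<close>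

lemma inv_set_subset_run_rev:
  assumes w: "w \<in> signed_perms n" and x: "x \<in> signed_perms n"
    and "inv_set x \<subseteq> inv_set w" and "\<And>g. g \<notin> ascents w \<Longrightarrow> (w (g + 1), w g) \<notin> inv_set x"
  shows "inv_set x \<subseteq> inv_set (run_rev w)"
proof clarify
  fix a b assume ab: "(a, b) \<in> inv_set x"
  let ?A = "ascents w" and ?p = "inv' w b" and ?q = "inv' w a"
  note A = sym_cuts_unbounded[OF ascents_sym_cuts[OF w]]
  have less: "a < b" "?p < ?q" "inv' x b < inv' x a"
    using ab assms(3) by (auto simp: inv_set_def)
  have "\<exists>g. ?p \<le> g \<and> g < ?q \<and> g \<in> ?A"
  proof (rule ccontr)
    assume "\<not> ?thesis"
    then have run: "g \<notin> ?A" if "?p \<le> g" "g < ?q" for g using that by blast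
    \<comment> \<open>Along the run, the places that its values occupy in \<open>x\<close> move
      weakly to the left, by the hypothesis on neighbours.\<close>
    have "inv' x (w q) \<le> inv' x (w ?p)" if "?p \<le> q" "q \<le> ?q" for q
      using that
    proof (induction q rule: int_ge_induct)
      case (step i)
      then have "i \<notin> ?A" using run by simp
      then have "inv' x (w (i + 1)) \<le> inv' x (w i)"
        using assms(4)[of i] not_ascent[OF signed_perms_inj[OF w], of i] by (simp add: inv_set_def)
      then show ?case using step by simp
    qed simp
    from this[of ?q] have "inv' x a \<le> inv' x b" using less w by simp
    then show False using less by simp
  qed
  then have "block_rev ?A ?p < block_rev ?A ?q" using block_rev_less_diff[OF A] by blast
  then show "(a, b) \<in> inv_set (run_rev w)" using less by (simp add: inv_set_def inv_run_rev[OF w])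
qed

section \<open>The hyperoctahedral group as a Coxeter group\<close>

definition shift_perm :: "nat \<Rightarrow> (nat \<Rightarrow> nat) \<Rightarrow> int \<Rightarrow> int"
  where "shift_perm n w p =
    (if p \<in> {1 - int n..int n} then int (w (nat (p + int n))) - int n else p)"

definition unshift_perm :: "nat \<Rightarrow> (int \<Rightarrow> int) \<Rightarrow> nat \<Rightarrow> nat"
  where "unshift_perm n v i = (if i \<in> {1..2*n} then nat (v (int i - int n) + int n) else i)"

lemma hyperoct_carrier:
  "w \<in> carrier (hyperoct_group n) \<longleftrightarrow> w permutes {1..2*n} \<and> rev_perm n \<circ> w \<circ> rev_perm n = w"
  by (simp add: hyperoct_group_def sym_group_def)

lemma hyperoct_mult: "x \<otimes>\<^bsub>hyperoct_group n\<^esub> y = x \<circ> y"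
  by (simp add: hyperoct_group_def sym_group_def)

lemma hyperoct_one: "\<one>\<^bsub>hyperoct_group n\<^esub> = id"
  by (simp add: hyperoct_group_def sym_group_def)

lemma shift_perm_comp:
  assumes "w permutes {1..2*n}"
  shows "shift_perm n (v \<circ> w) = shift_perm n v \<circ> shift_perm n w"
proof
  fix p
  show "shift_perm n (v \<circ> w) p = (shift_perm n v \<circ> shift_perm n w) p"
  proof (cases "p \<in> {1 - int n..int n}")
    case True
    then have "nat (p + int n) \<in> {1..2*n}" by auto
    then have "w (nat (p + int n)) \<in> {1..2*n}" using permutes_in_image[OF assms] by blast
    then show ?thesis using True by (auto simp: shift_perm_def)
  next
    case False
    then show ?thesis by (auto simp: shift_perm_def)
  qed
qed

lemma shift_perm_id: "shift_perm n id = id"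
  by (auto simp: shift_perm_def fun_eq_iff)

lemma shift_perm_permutes:
  assumes w: "w permutes {1..2*n}"
  shows "shift_perm n w permutes {1 - int n..int n}"
proof -
  let ?v = "inv' w"
  have "shift_perm n ?v \<circ> shift_perm n w = id" "shift_perm n w \<circ> shift_perm n ?v = id"
    using shift_perm_comp[OF w, of ?v] shift_perm_comp[OF permutes_inv[OF w], of w]
      permutes_inv_o[OF w] by (simp_all add: shift_perm_id)
  then have "bij (shift_perm n w)" by (rule o_bij)
  then show ?thesis by (auto simp: permutes_def bij_iff shift_perm_def)
qed

lemma shift_perm_signed_perms:
  assumes "w \<in> carrier (hyperoct_group n)"
  shows "shift_perm n w \<in> signed_perms n"
proof -
  have w: "w permutes {1..2*n}" and rev: "rev_perm n (w (rev_perm n i)) = w i" for i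
    using assms by (auto simp: hyperoct_carrier fun_eq_iff)
  have "shift_perm n w (1 - p) = 1 - shift_perm n w p" for p
  proof (cases "p \<in> {1 - int n..int n}")
    case True
    define i where "i = nat (p + int n)"
    have i: "i \<in> {1..2*n}" "p = int i - int n" using True by (auto simp: i_def)
    have wi: "w i \<in> {1..2*n}" using permutes_in_image[OF w] i(1) by blast
    have "nat (1 - p + int n) = rev_perm n i" using i by (auto simp: rev_perm_def)
    moreover have "w (rev_perm n i) = rev_perm n (w i)" using rev[of i] by (metis rev_perm_rev_perm)
    moreover have "int (rev_perm n (w i)) = 2 * int n + 1 - int (w i)"
      using wi by (auto simp: rev_perm_def)
    ultimately show ?thesis using True by (auto simp: shift_perm_def i_def)
  qed (auto simp: shift_perm_def)
  then show ?thesis using shift_perm_permutes[OF w] by (simp add: signed_perms_def)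
qed

lemma shift_perm_inject:
  assumes "v permutes {1..2*n}" "w permutes {1..2*n}" "shift_perm n v = shift_perm n w"
  shows "v = w"
proof
  fix i
  show "v i = w i"
  proof (cases "i \<in> {1..2*n}")
    case True
    then show ?thesis using fun_cong[OF assms(3), of "int i - int n"] by (auto simp: shift_perm_def)
  next
    case False
    then show ?thesis using permutes_not_in[OF assms(1)] permutes_not_in[OF assms(2)] by simp
  qed
qed

lemma shift_perm_unshift_perm:
  assumes v: "v \<in> signed_perms n"
  shows "shift_perm n (unshift_perm n v) = v"
proof
  fix p
  show "shift_perm n (unshift_perm n v) p = v p"
    using permutes_in_image[OF signed_perms_permutes[OF v], of p]
      permutes_not_in[OF signed_perms_permutes[OF v], of p]
    by (auto simp: shift_perm_def unshift_perm_def)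
qed

lemma unshift_perm_carrier:
  assumes v: "v \<in> signed_perms n"
  shows "unshift_perm n v \<in> carrier (hyperoct_group n)"
proof -
  let ?w = "unshift_perm n v" and ?w' = "unshift_perm n (inv' v)"
  have mem: "int i - int n \<in> {1 - int n..int n} \<longleftrightarrow> i \<in> {1..2*n}" for i by auto
  have range: "v (int i - int n) \<in> {1 - int n..int n}" if "v \<in> signed_perms n" "i \<in> {1..2*n}" for v i
    using permutes_in_image[OF signed_perms_permutes[OF that(1)]] mem that(2) by blast
  have inverse: "unshift_perm n (inv' v) (unshift_perm n v i) = i" if v: "v \<in> signed_perms n" for v i
    using range[OF v, of i] v by (auto simp: unshift_perm_def)
  have inv_inv: "inv' (inv' v) = v"
    by (intro inv_inv_eq permutes_bij[OF signed_perms_permutes[OF v]])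
  have maps: "unshift_perm n v i \<in> {1..2*n}" if "v \<in> signed_perms n" "i \<in> {1..2*n}" for v i
    using range[OF that] that(2) by (auto simp: unshift_perm_def)
  have "bij_betw ?w {1..2*n} {1..2*n}"
    using inverse[OF v] inverse[OF inv_in_signed_perms[OF v]] maps[OF v]
      maps[OF inv_in_signed_perms[OF v]] unfolding inv_inv
    by (intro bij_betw_byWitness[where f' = ?w']) blast+
  then have "?w permutes {1..2*n}" by (rule bij_imp_permutes) (simp only: unshift_perm_def if_False)
  moreover have "rev_perm n (?w (rev_perm n i)) = ?w i" for i
  proof (cases "i \<in> {1..2*n}")
    case True
    have "int (rev_perm n i) - int n = 1 - (int i - int n)" using True by (auto simp: rev_perm_def)
    then have "v (int (rev_perm n i) - int n) = 1 - v (int i - int n)"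
      using signed_perms_sym[OF v] by metis
    then show ?thesis using True range[OF v True] by (auto simp: unshift_perm_def rev_perm_def)
  qed (auto simp: unshift_perm_def rev_perm_def)
  ultimately show ?thesis by (simp add: hyperoct_carrier fun_eq_iff)
qed

lemma bij_betw_shift_perm: "bij_betw (shift_perm n) (carrier (hyperoct_group n)) (signed_perms n)"
  unfolding bij_betw_def
proof
  show "inj_on (shift_perm n) (carrier (hyperoct_group n))"
    by (auto intro!: inj_onI shift_perm_inject simp: hyperoct_carrier)
  show "shift_perm n ` carrier (hyperoct_group n) = signed_perms n"
    using shift_perm_signed_perms shift_perm_unshift_perm unshift_perm_carrier
    by (auto simp: image_iff) metis
qed

lemma shift_perm_simple_transp:
  assumes "1 \<le> i" "i < 2 * n"
  shows "shift_perm n (simple_transp i) = Transposition.transpose (int i - int n) (int i + 1 - int n)"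
  using assms by (auto simp: fun_eq_iff shift_perm_def simple_transp_def Transposition.transpose_def)

text \<open>After the shift by \<open>n\<close> the factor \<open>simple_transp (2*n - i)\<close>
  swaps \<open>n - i\<close> with \<open>n - i + 1\<close> and \<open>simple_transp i\<close> swaps
  the mirror images, so the index becomes \<open>n - i\<close>.\<close>

lemma shift_perm_gens:
  assumes "n \<ge> 1"
  shows "shift_perm n ` hyperoct_gens n = sgen ` {0..<int n}"
proof -
  have pair: "shift_perm n (simple_transp i \<circ> simple_transp (2*n - i)) = sgen (int (n - i))"
    if i: "1 \<le> i" "i < n" for i
  proof -
    have "simple_transp (2*n - i) permutes {1..2*n}"
      using i by (intro simple_transp_permutes) auto
    then have "shift_perm n (simple_transp i \<circ> simple_transp (2*n - i))
        = Transposition.transpose (int i - int n) (int i + 1 - int n)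
          \<circ> Transposition.transpose (int (2*n - i) - int n) (int (2*n - i) + 1 - int n)"
      using i by (simp add: shift_perm_comp shift_perm_simple_transp)
    also have "\<dots> = sgen (int (n - i))"
      using i by (auto simp: fun_eq_iff sgen_def Transposition.transpose_def of_nat_diff)
    finally show ?thesis .
  qed
  have mid: "shift_perm n (simple_transp n) = sgen 0"
    using assms by (subst shift_perm_simple_transp)
      (auto simp: fun_eq_iff sgen_def Transposition.transpose_def)
  have "hyperoct_gens n = (\<lambda>i. simple_transp i \<circ> simple_transp (2*n - i)) ` {1..<n} \<union> {simple_transp n}"
    unfolding hyperoct_gens_def by auto
  then have "shift_perm n ` hyperoct_gens n = (\<lambda>i. sgen (int (n - i))) ` {1..<n} \<union> {sgen 0}"
    using pair mid by (auto simp: image_Un image_image)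
  also have "\<dots> = sgen ` ((\<lambda>i. int (n - i)) ` {1..<n} \<union> {0})"
    by (simp add: image_image)
  also have "(\<lambda>i. int (n - i)) ` {1..<n} \<union> {0} = {0..<int n}"
  proof (intro equalityI subsetI)
    fix g assume "g \<in> {0..<int n}"
    then have "g = 0 \<or> g = int (n - nat (int n - g)) \<and> nat (int n - g) \<in> {1..<n}" by auto
    then show "g \<in> (\<lambda>i. int (n - i)) ` {1..<n} \<union> {0}" by blast
  qed (use assms in auto)
  finally show ?thesis .
qed

lemma word_prod_append: "word_prod (hyperoct_group n) (xs @ ys)
    = word_prod (hyperoct_group n) xs \<circ> word_prod (hyperoct_group n) ys"
  by (induction xs) (simp_all add: word_prod_def hyperoct_mult hyperoct_one comp_assoc)

lemma word_prod_Nil: "word_prod (hyperoct_group n) [] = id"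
  by (simp add: word_prod_def hyperoct_one)

lemma word_prod_single: "word_prod (hyperoct_group n) [s] = s"
  by (simp add: word_prod_def hyperoct_one hyperoct_mult)

section \<open>Length, descents, weak order and Pop expressed by inversions\<close>

locale hyperoct =
  fixes n :: nat
  assumes n: "n \<ge> 1"
begin

abbreviation "W \<equiv> hyperoct_group n"
abbreviation "S \<equiv> hyperoct_gens n"
abbreviation "\<phi> \<equiv> shift_perm n"
abbreviation "len \<equiv> cox_length W S"

sublocale group W
  by (rule hyperoct_group_is_group)

lemma \<phi>_mult: "x \<in> carrier W \<Longrightarrow> y \<in> carrier W \<Longrightarrow> \<phi> (x \<otimes>\<^bsub>W\<^esub> y) = \<phi> x \<circ> \<phi> y"
  by (simp add: hyperoct_mult hyperoct_carrier shift_perm_comp)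

lemma \<phi>_inj: "x \<in> carrier W \<Longrightarrow> y \<in> carrier W \<Longrightarrow> \<phi> x = \<phi> y \<longleftrightarrow> x = y"
  using bij_betw_shift_perm[of n] by (auto simp: bij_betw_def inj_on_def)

lemma \<phi>_surj: "v \<in> signed_perms n \<Longrightarrow> \<exists>x\<in>carrier W. \<phi> x = v"
  using bij_betw_imp_surj_on[OF bij_betw_shift_perm[of n]] by (metis imageE)

lemma \<phi>_inv: "x \<in> carrier W \<Longrightarrow> \<phi> (inv\<^bsub>W\<^esub> x) = inv' (\<phi> x)"
proof -
  assume x: "x \<in> carrier W"
  have "\<phi> (inv\<^bsub>W\<^esub> x) \<circ> \<phi> x = id" "\<phi> x \<circ> \<phi> (inv\<^bsub>W\<^esub> x) = id"
    using x by (simp_all flip: \<phi>_mult) (simp_all add: hyperoct_one shift_perm_id)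
  then show ?thesis by (intro inv_unique_comp[symmetric])
qed

lemma gen_sgen:
  assumes "s \<in> S"
  obtains g where "0 \<le> g" "g < int n" "\<phi> s = sgen g"
proof -
  have "\<phi> s \<in> sgen ` {0..<int n}" using assms shift_perm_gens[OF n] by blast
  then show ?thesis using that by auto
qed

lemma sgen_gen:
  assumes "0 \<le> g" "g < int n"
  obtains s where "s \<in> S" "\<phi> s = sgen g"
proof -
  have "sgen g \<in> \<phi> ` S" using assms shift_perm_gens[OF n] by auto
  then show ?thesis using that by auto
qed

lemma gens_carrier: "s \<in> S \<Longrightarrow> s \<in> carrier W"
  using hyperoct_gens_subset[OF n] by blast

lemma wlen_word_prod_le:
  assumes "set ss \<subseteq> S"
  shows "word_prod W ss \<in> carrier W \<and> wlen (\<phi> (word_prod W ss)) \<le> 2 * length ss"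
  using assms
proof (induction ss rule: rev_induct)
  case Nil
  have "id \<in> carrier W" using one_closed by (simp only: hyperoct_one)
  then show ?case by (simp only: word_prod_Nil shift_perm_id wlen_def inv_set_id sum.empty le0 simp_thms)
next
  case (snoc s ss)
  let ?x = "word_prod W ss"
  have x: "?x \<in> carrier W" "wlen (\<phi> ?x) \<le> 2 * length ss" and s: "s \<in> S" using snoc by auto
  have eq: "word_prod W (ss @ [s]) = ?x \<otimes>\<^bsub>W\<^esub> s"
    by (simp add: word_prod_append word_prod_single hyperoct_mult)
  obtain g where g: "0 \<le> g" "g < int n" "\<phi> s = sgen g" using gen_sgen[OF s] .
  have "wlen (\<phi> ?x \<circ> sgen g) \<le> wlen (\<phi> ?x) + 2"
    using wlen_comp_sgen_ascent[OF shift_perm_signed_perms[OF x(1)], of g]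
      wlen_comp_sgen_descent[OF shift_perm_signed_perms[OF x(1)], of g] g(1,2)
    by (cases "g \<in> ascents (\<phi> ?x)") auto
  then have "wlen (\<phi> (?x \<otimes>\<^bsub>W\<^esub> s)) \<le> 2 * length (ss @ [s])"
    unfolding \<phi>_mult[OF x(1) gens_carrier[OF s]] g(3) length_append using x(2) by simp
  then show ?case
    unfolding eq using x(1) gens_carrier[OF s] by simp
qed

text \<open>Sorting: unless \<open>w\<close> is the identity it has a descent, and the corresponding
  generator lowers \<open>wlen\<close> by exactly 2.\<close>

lemma wlen_word_exists:
  assumes "w \<in> carrier W"
  shows "\<exists>ss. set ss \<subseteq> S \<and> 2 * length ss = wlen (\<phi> w) \<and> word_prod W ss = w"
  using assms
proof (induction "wlen (\<phi> w)" arbitrary: w rule: less_induct)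
  case less
  note w = shift_perm_signed_perms[OF less.prems]
  show ?case
  proof (cases "\<forall>g. g \<in> ascents (\<phi> w)")
    case True
    then have "\<phi> w = id" using signed_perms_no_descents[OF w] by blast
    moreover from this have "w = id"
      using \<phi>_inj[OF less.prems one_closed] by (simp add: hyperoct_one shift_perm_id)
    ultimately show ?thesis
      by (intro exI[of _ "[]"]) (simp add: word_prod_Nil wlen_def inv_set_id)
  next
    case False
    then obtain h where h: "h \<notin> ascents (\<phi> w)" by blast
    \<comment> \<open>Generators have nonnegative index, and descents are symmetric under
      \<open>h\<close> to \<open>- h\<close>.\<close>
    define g where "g = \<bar>h\<bar>"
    have desc: "g \<notin> ascents (\<phi> w)" using h neg_ascents[OF w] by (auto simp: g_def abs_if)
    then have g: "0 \<le> g" "g < int n"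
      using descent_bound[OF w] by (force simp: g_def)+
    obtain s where s: "s \<in> S" "\<phi> s = sgen g" using sgen_gen[OF g] .
    let ?v = "w \<otimes>\<^bsub>W\<^esub> s"
    have v: "?v \<in> carrier W" using less.prems gens_carrier[OF s(1)] by simp
    have len: "wlen (\<phi> w) = wlen (\<phi> ?v) + 2"
      using wlen_comp_sgen_descent[OF w _ desc] g s less.prems gens_carrier[OF s(1)]
      by (simp add: \<phi>_mult)
    then obtain ss where ss: "set ss \<subseteq> S" "2 * length ss = wlen (\<phi> ?v)" "word_prod W ss = ?v"
      using less.hyps[of ?v] v by auto
    have "word_prod W (ss @ [s]) = w"
    proof (rule \<phi>_inj[THEN iffD1])
      show "word_prod W (ss @ [s]) \<in> carrier W" using wlen_word_prod_le[of "ss @ [s]"] ss(1) s(1) by auto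
      have "\<phi> (word_prod W (ss @ [s])) = \<phi> (?v \<otimes>\<^bsub>W\<^esub> s)"
        by (simp only: word_prod_append word_prod_single ss(3) hyperoct_mult)
      also have "\<dots> = \<phi> w \<circ> sgen g \<circ> sgen g"
        using less.prems gens_carrier[OF s(1)] v s(2) by (simp only: \<phi>_mult)
      also have "\<dots> = \<phi> w" by (simp add: fun_eq_iff sgen_sgen)
      finally show "\<phi> (word_prod W (ss @ [s])) = \<phi> w" .
    qed (rule less.prems)
    then show ?thesis using ss s len by (intro exI[of _ "ss @ [s]"]) auto
  qed
qed

lemma cox_length_wlen:
  assumes w: "w \<in> carrier W"
  shows "2 * len w = wlen (\<phi> w)"
proof -
  obtain ss where ss: "set ss \<subseteq> S" "2 * length ss = wlen (\<phi> w)" "word_prod W ss = w"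
    using wlen_word_exists[OF w] by blast
  have "len w = length ss"
    unfolding cox_length_def
  proof (rule Least_equality)
    fix k assume "\<exists>ts. set ts \<subseteq> S \<and> length ts = k \<and> word_prod W ts = w"
    then show "length ss \<le> k" using wlen_word_prod_le ss(2) by fastforce
  qed (use ss in blast)
  then show ?thesis using ss(2) by simp
qed

lemma right_weak_order_iff:
  assumes x: "x \<in> carrier W" and y: "y \<in> carrier W"
  shows "x \<sqsubseteq>\<^bsub>right_weak_order W S\<^esub> y \<longleftrightarrow> inv_set (\<phi> x) \<subseteq> inv_set (\<phi> y)"
proof -
  have "wlen (inv' (\<phi> x) \<circ> \<phi> y) = 2 * len (inv\<^bsub>W\<^esub> x \<otimes>\<^bsub>W\<^esub> y)"
    using x y by (simp add: cox_length_wlen \<phi>_mult \<phi>_inv)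
  then show ?thesis
    unfolding inv_set_subset_iff[OF shift_perm_signed_perms[OF x] shift_perm_signed_perms[OF y], symmetric]
    using cox_length_wlen[OF x] cox_length_wlen[OF y] by (auto simp: right_weak_order_def)
qed

lemma right_descents_iff:
  assumes w: "w \<in> carrier W" and s: "s \<in> S" "\<phi> s = sgen g" "\<bar>g\<bar> < int n"
  shows "s \<in> right_descents W S w \<longleftrightarrow> g \<notin> ascents (\<phi> w)"
proof -
  note \<phi>w = shift_perm_signed_perms[OF w]
  have "w \<otimes>\<^bsub>W\<^esub> s \<in> carrier W" using w gens_carrier[OF s(1)] by simp
  then have "2 * len (w \<otimes>\<^bsub>W\<^esub> s) = wlen (\<phi> w \<circ> sgen g)"
    using w gens_carrier[OF s(1)] s(2) by (simp add: cox_length_wlen \<phi>_mult)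
  then show ?thesis
    using wlen_comp_sgen_ascent[OF \<phi>w s(3)] wlen_comp_sgen_descent[OF \<phi>w s(3)] cox_length_wlen[OF w] s(1)
    by (cases "g \<in> ascents (\<phi> w)") (auto simp: right_descents_def)
qed

text \<open>A generator at a descent removes just the descent pair and its mirror image from the
  inversion set. The lower bounds are therefore the elements below \<open>w\<close> that omit all
  descent pairs, and run reversal is the largest of them.\<close>

lemma greatest_lower_run_rev:
  assumes w: "w \<in> carrier W" and r: "r \<in> carrier W" "\<phi> r = run_rev (\<phi> w)"
  shows "greatest (right_weak_order W S) r
    (Lower (right_weak_order W S) ({w \<otimes>\<^bsub>W\<^esub> s | s. s \<in> right_descents W S w} \<union> {w}))"
proof -
  let ?L = "right_weak_order W S" and ?A = "{w \<otimes>\<^bsub>W\<^esub> s | s. s \<in> right_descents W S w} \<union> {w}"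
  note \<phi>w = shift_perm_signed_perms[OF w]
  have car: "carrier ?L = carrier W" by (simp add: right_weak_order_def)
  have mult: "w \<otimes>\<^bsub>W\<^esub> s \<in> carrier W" "\<phi> (w \<otimes>\<^bsub>W\<^esub> s) = \<phi> w \<circ> \<phi> s" if "s \<in> S" for s
    using w gens_carrier[OF that] by (simp_all add: \<phi>_mult)
  have "r \<sqsubseteq>\<^bsub>?L\<^esub> x" if x: "x \<in> ?A" for x
  proof -
    consider "x = w" | s where "x = w \<otimes>\<^bsub>W\<^esub> s" "s \<in> right_descents W S w" using x by auto
    then show ?thesis
    proof cases
      case 1
      then show ?thesis
        using right_weak_order_iff[OF r(1) w] inv_set_run_rev_subset[OF \<phi>w] r(2) by simp
    next
      case 2
      then have s: "s \<in> S" by (simp add: right_descents_def)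
      obtain g where g: "0 \<le> g" "g < int n" "\<phi> s = sgen g" using gen_sgen[OF s] .
      have desc: "g \<notin> ascents (\<phi> w)" using right_descents_iff[OF w s g(3)] g 2 by simp
      then have "- g \<notin> ascents (\<phi> w)" using neg_ascents[OF \<phi>w] by simp
      then have "inv_set (run_rev (\<phi> w)) \<subseteq> inv_set (\<phi> w \<circ> sgen g)"
        using inv_set_comp_sgen_descent[OF \<phi>w _ desc] g inv_set_run_rev_subset[OF \<phi>w]
          descent_notin_inv_set_run_rev[OF \<phi>w desc] descent_notin_inv_set_run_rev[OF \<phi>w, of "- g"]
        by auto
      then show ?thesis
        using right_weak_order_iff[OF r(1) mult(1)[OF s]] mult(2)[OF s] r(2) g(3) 2(1) by simp
    qed
  qed
  then have lower: "r \<in> Lower ?L ?A" using r(1) by (auto simp: Lower_def car)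
  moreover have "x \<sqsubseteq>\<^bsub>?L\<^esub> r" if x: "x \<in> Lower ?L ?A" for x
  proof -
    have xW: "x \<in> carrier W" using x by (auto simp: Lower_def car)
    have le: "x \<sqsubseteq>\<^bsub>?L\<^esub> y" if "y \<in> ?A" "y \<in> carrier W" for y
      using x that by (auto simp: Lower_def car)
    have "(\<phi> w (g + 1), \<phi> w g) \<notin> inv_set (\<phi> x)" if "g \<notin> ascents (\<phi> w)" for g
    proof -
      \<comment> \<open>A descent at negative \<open>g\<close> is handled by the generator with
        index \<open>\<bar>g\<bar>\<close>, which also removes the mirrored pair.\<close>
      have desc: "\<bar>g\<bar> \<notin> ascents (\<phi> w)" using that neg_ascents[OF \<phi>w] by (auto simp: abs_if)
      have g: "0 \<le> \<bar>g\<bar>" "\<bar>g\<bar> < int n" using descent_bound[OF \<phi>w that] by simp_all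
      obtain s where s: "s \<in> S" "\<phi> s = sgen \<bar>g\<bar>" using sgen_gen[OF g] .
      have "s \<in> right_descents W S w" using right_descents_iff[OF w s] g desc by simp
      then have "x \<sqsubseteq>\<^bsub>?L\<^esub> w \<otimes>\<^bsub>W\<^esub> s" using mult(1)[OF s(1)] by (intro le) blast+
      then have "inv_set (\<phi> x) \<subseteq> inv_set (\<phi> w \<circ> sgen \<bar>g\<bar>)"
        using right_weak_order_iff[OF xW mult(1)[OF s(1)]] mult(2)[OF s(1)] s(2) by simp
      then show ?thesis
        using inv_set_comp_sgen_descent[OF \<phi>w _ desc] g
        by (cases "g \<ge> 0") (auto simp: add.commute)
    qed
    moreover have "inv_set (\<phi> x) \<subseteq> inv_set (\<phi> w)"
      using le[of w] w right_weak_order_iff[OF xW w] by simp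
    ultimately show ?thesis
      using inv_set_subset_run_rev[OF \<phi>w shift_perm_signed_perms[OF xW]] right_weak_order_iff[OF xW r(1)] r(2)
      by simp
  qed
  ultimately show ?thesis by (auto simp: greatest_def Lower_def car)
qed

lemma pop_run_rev:
  assumes w: "w \<in> carrier W"
  shows "pop W S w \<in> carrier W" "\<phi> (pop W S w) = run_rev (\<phi> w)"
proof -
  obtain r where r: "r \<in> carrier W" "\<phi> r = run_rev (\<phi> w)"
    using \<phi>_surj[OF run_rev_signed_perms[OF shift_perm_signed_perms[OF w]]] by blast
  note glb = greatest_lower_run_rev[OF w r]
  have "pop W S w = r"
    unfolding pop_def inf_def
  \<comment> \<open>The meet is a Hilbert choice among greatest lower bounds, so their uniqueness is
    needed; it follows from antisymmetry, as an element is determined by its inversion set.\<close>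
  proof (rule some_equality, rule glb)
    let ?L = "right_weak_order W S"
    fix x assume x: "greatest ?L x (Lower ?L ({w \<otimes>\<^bsub>W\<^esub> s | s. s \<in> right_descents W S w} \<union> {w}))"
    then have xW: "x \<in> carrier W" by (auto simp: greatest_def Lower_def right_weak_order_def)
    have "x \<sqsubseteq>\<^bsub>?L\<^esub> r" "r \<sqsubseteq>\<^bsub>?L\<^esub> x" using x glb by (simp_all add: greatest_def)
    then have "inv_set (\<phi> x) = inv_set (\<phi> r)"
      using right_weak_order_iff xW r(1) by blast
    then show "x = r"
      using inv_set_inject[OF shift_perm_signed_perms[OF xW] shift_perm_signed_perms[OF r(1)]] \<phi>_inj xW r(1)
      by blast
  qed
  with r show "pop W S w \<in> carrier W" "\<phi> (pop W S w) = run_rev (\<phi> w)" by simp_all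
qed

lemma funpow_pop_run_rev:
  assumes "w \<in> carrier W"
  shows "(pop W S ^^ t) w \<in> carrier W \<and> \<phi> ((pop W S ^^ t) w) = (run_rev ^^ t) (\<phi> w)"
  using assms pop_run_rev by (induction t) auto

lemma card_pop_preimage_one:
  "card (pop_preimage_one W S t) = card {w \<in> signed_perms n. (run_rev ^^ t) w = id}"
proof (rule bij_betw_same_card)
  have "(pop W S ^^ t) w = \<one>\<^bsub>W\<^esub> \<longleftrightarrow> (run_rev ^^ t) (\<phi> w) = id" if "w \<in> carrier W" for w
    using funpow_pop_run_rev[OF that, of t] \<phi>_inj[OF _ one_closed]
    by (metis hyperoct_one shift_perm_id)
  then have "pop_preimage_one W S t = {w \<in> carrier W. (run_rev ^^ t) (\<phi> w) = id}"
    by (auto simp: pop_preimage_one_def)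
  moreover have "bij_betw \<phi> \<dots> {w \<in> signed_perms n. (run_rev ^^ t) w = id}"
    using bij_betw_shift_perm[of n] by (auto simp: bij_betw_def inj_on_def)
  ultimately show "bij_betw \<phi> (pop_preimage_one W S t) {w \<in> signed_perms n. (run_rev ^^ t) w = id}"
    by simp
qed

end

theorem theorem1p9:
  fixes t :: nat
  shows "rational_fps (Abs_fps (\<lambda>n.
           if n \<ge> 1
           then of_nat (card (pop_preimage_one (hyperoct_group n) (hyperoct_gens n) t))
           else 0) :: rat fps)"
proof -
  let ?c = "\<lambda>n. of_nat (card {w \<in> signed_perms n. (run_rev ^^ t) w = id}) :: rat"
  \<comment> \<open>The counting series also has a term for \<open>n = 0\<close>, which the sum over
    positive \<open>n\<close> excludes.\<close>
  have "rational_fps (Abs_fps ?c - fps_const (?c 0))"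
    by (intro rational_fps_diff rational_fps_signed_perms rational_fps_const)
  also have "Abs_fps ?c - fps_const (?c 0) = Abs_fps (\<lambda>n. if n \<ge> 1
      then of_nat (card (pop_preimage_one (hyperoct_group n) (hyperoct_gens n) t)) else 0)"
    using hyperoct.card_pop_preimage_one[OF hyperoct.intro] by (intro fps_ext) (auto simp: Suc_le_eq)
  finally show ?thesis .
qed

end
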